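(* Assume that for every $g\in L^2(\Omega)$ the problem $-A:D^2 v=g$ in $\Omega$, $v=0$ on $\partial\Omega$, has a unique solution $v\in V$. Let $f\in L^2(\Omega)$ and let $(u,\boldsymbol\sigma)\in H^1_0(\Omega)\times Q$ be the solution of the least-squares minimization problem over $H^1_0(\Omega)\times Q$ (so $u$ solves $-A:D^2u=f$, $u|_{\partial\Omega}=0$, and $\boldsymbol\sigma=\nabla u$). (i) If $k\ge2$ and $(u_h,\boldsymbol\sigma_h)\in S_{k,0}\times S_{k-1}^d$ minimizes $\mathcal{J}_h(\cdot,\cdot;f)$ over $S_{k,0}\times S_{k-1}^d$ (the weighted-LSFEM solution), then $$|||(u-u_h,\boldsymbol\sigma-\boldsymbol\sigma_h)|||_h\le\inf_{(v_h,\boldsymbol\tau_h)\in S_{k,0}\times S_{k-1}^d}|||(u-v_h,\boldsymbol\sigma-\boldsymbol\tau_h)|||_h .$$ (ii) If $(u_h,\boldsymbol\sigma_h)\in S_{1,0}\times S_1^d$ minimizes $\mathcal{J}_0(\cdot,\cdot;f)$ over $S_{1,0}\times S_1^d$ (the $L^2$-LSFEM solution), then $$|||(u-u_h,\boldsymbol\sigma-\boldsymbol\sigma_h)|||_0\le\inf_{(v_h,\boldsymbol\tau_h)\in S_{1,0}\times S_1^d}|||(u-v_h,\boldsymbol\sigma-\boldsymbol\tau_h)|||_0 .$$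
   Context: Setting: $d\in\{2,3\}$, $\Omega\subset\mathbb{R}^d$ is a bounded open polytope, $A=(a_{ij})\in L^\infty(\Omega)^{d\times d}$ (possibly degenerate). $A:B=\sum_{i,j}a_{ij}b_{ij}$; $D^2v$ is the Hessian. $\|\cdot\|_{k,\omega}$ is the $H^k(\omega)$ norm, with $\omega$ omitted when $\omega=\Omega$. Spaces: $V=\{v\in H^1_0(\Omega): A:D^2v\in L^2(\Omega)\}$, $Q=\{\boldsymbol\tau\in L^2(\Omega)^d: A:\nabla\boldsymbol\tau\in L^2(\Omega)\}$. Convention: $A:\nabla\boldsymbol\tau=\sum_{i,j}a_{ij}\,\partial_j\tau_i$ is linear in $\boldsymbol\tau$, coincides with the a.e. expression for $\boldsymbol\tau\in H^1(\Omega)^d$, and $A:\nabla(\nabla v)=A:D^2v$. Mesh: $\mathcal{T}=\{K\}$ is a shape-regular simplicial triangulation of $\Omega$, $h_K=\operatorname{diam}K$. $S_k=\{v\in H^1(\Omega): v|_K\in P_k(K)\ \forall K\in\mathcal{T}\}$, $S_{k,0}=S_k\cap H^1_0(\Omega)$. Functionals and norms on $H^1_0(\Omega)\times Q$: $$\mathcal{J}_h(v,\boldsymbol\tau;f)=\sum_{K\in\mathcal{T}}h_K^2\|f+A:\nabla\boldsymbol\tau\|_{0,K}^2+\|\boldsymbol\tau-\nabla v\|_0^2,\qquad \mathcal{J}_0(v,\boldsymbol\tau;f)=\|f+A:\nabla\boldsymbol\tau\|_0^2+\|\boldsymbol\tau-\nabla v\|_0^2,$$ $$|||(v,\boldsymbol\tau)|||_h^2=\sum_{K\in\mathcal{T}}h_K^2\|A:\nabla\boldsymbol\tau\|_{0,K}^2+\|\boldsymbol\tau-\nabla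 v\|_0^2,\qquad |||(v,\boldsymbol\tau)|||_0^2=\|A:\nabla\boldsymbol\tau\|_0^2+\|\boldsymbol\tau-\nabla v\|_0^2 .$$ *)

theory Defs
  imports "HOL-Analysis.Analysis"
begin

(* Elements of L^2(Om), H^1(Om), ... are represented by functions on the whole space.  Only
   their values on Om matter, and equality of elements is equality a.e. on Om. *)

definition L2 :: "'a::euclidean_space set \<Rightarrow> ('a \<Rightarrow> 'b::euclidean_space) set" where
  "L2 \<Omega> = {f. f \<in> borel_measurable (lebesgue_on \<Omega>) \<and>
              integrable (lebesgue_on \<Omega>) (\<lambda>x. (norm (f x))\<^sup>2)}"

definition L2norm :: "'a::euclidean_space set \<Rightarrow> ('a \<Rightarrow> 'b::euclidean_space) \<Rightarrow> real" where
  "L2norm \<omega> f = sqrt (\<integral>x. (norm (f x))\<^sup>2 \<partial>lebesgue_on \<omega>)"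

definition Linfty :: "'a::euclidean_space set \<Rightarrow> ('a \<Rightarrow> 'b::euclidean_space) set" where
  "Linfty \<Omega> = {f. f \<in> borel_measurable (lebesgue_on \<Omega>) \<and>
                  (\<exists>M. AE x in lebesgue_on \<Omega>. norm (f x) \<le> M)}"

definition partial :: "'n::finite \<Rightarrow> (real^'n \<Rightarrow> real) \<Rightarrow> real^'n \<Rightarrow> real" where
  "partial j \<phi> x = frechet_derivative \<phi> (at x) (axis j 1)"

fun Ck :: "nat \<Rightarrow> (real^'n::finite \<Rightarrow> real) \<Rightarrow> bool" where
  "Ck 0 \<phi> \<longleftrightarrow> continuous_on UNIV \<phi>"
| "Ck (Suc m) \<phi> \<longleftrightarrow> (\<forall>x. \<phi> differentiable (at x)) \<and> (\<forall>j. Ck m (partial j \<phi>))"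

definition test_functions :: "(real^'n::finite) set \<Rightarrow> (real^'n \<Rightarrow> real) set" where
  "test_functions \<Omega> = {\<phi>. (\<forall>m. Ck m \<phi>) \<and>
      compact (closure {x. \<phi> x \<noteq> 0}) \<and> closure {x. \<phi> x \<noteq> 0} \<subseteq> \<Omega>}"

definition is_weak_gradient ::
  "(real^'n::finite) set \<Rightarrow> (real^'n \<Rightarrow> real) \<Rightarrow> (real^'n \<Rightarrow> real^'n) \<Rightarrow> bool" where
  "is_weak_gradient \<Omega> v g \<longleftrightarrow> v \<in> L2 \<Omega> \<and> g \<in> L2 \<Omega> \<and>
     (\<forall>\<phi>\<in>test_functions \<Omega>. \<forall>j.
        (\<integral>x. v x * partial j \<phi> x \<partial>lebesgue_on \<Omega>) = - (\<integral>x. g x $ j * \<phi> x \<partial>lebesgue_on \<Omega>))"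

definition H1 :: "(real^'n::finite) set \<Rightarrow> (real^'n \<Rightarrow> real) set" where
  "H1 \<Omega> = {v. \<exists>g. is_weak_gradient \<Omega> v g}"

(* For open Om the weak gradient of v in H^1(Om) is unique a.e. on Om. *)
definition wgrad :: "(real^'n::finite) set \<Rightarrow> (real^'n \<Rightarrow> real) \<Rightarrow> real^'n \<Rightarrow> real^'n" where
  "wgrad \<Omega> v = (SOME g. is_weak_gradient \<Omega> v g)"

definition H1norm :: "(real^'n::finite) set \<Rightarrow> (real^'n \<Rightarrow> real) \<Rightarrow> real" where
  "H1norm \<Omega> v = sqrt ((L2norm \<Omega> v)\<^sup>2 + (L2norm \<Omega> (wgrad \<Omega> v))\<^sup>2)"

definition H10 :: "(real^'n::finite) set \<Rightarrow> (real^'n \<Rightarrow> real) set" where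
  "H10 \<Omega> = {v \<in> H1 \<Omega>. \<forall>\<epsilon>>0. \<exists>\<phi>\<in>test_functions \<Omega>. H1norm \<Omega> (\<lambda>x. v x - \<phi> x) < \<epsilon>}"

definition vec_space :: "('a \<Rightarrow> real) set \<Rightarrow> ('a \<Rightarrow> real^'n::finite) set" where
  "vec_space X = {\<tau>. \<forall>i. (\<lambda>x. \<tau> x $ i) \<in> X}"

definition frob :: "real^'n::finite^'n \<Rightarrow> real^'n^'n \<Rightarrow> real" where
  "frob A B = (\<Sum>i\<in>UNIV. \<Sum>j\<in>UNIV. A $ i $ j * B $ i $ j)"

definition wjacobian ::
  "(real^'n::finite) set \<Rightarrow> (real^'n \<Rightarrow> real^'n) \<Rightarrow> real^'n \<Rightarrow> real^'n^'n" where
  "wjacobian \<Omega> \<tau> x = (\<chi> i j. wgrad \<Omega> (\<lambda>y. \<tau> y $ i) x $ j)"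

(* For a merely bounded A and a general L^2 field tau, the product of a_ij with the distribution
   d_j tau_i has no canonical meaning.  The operator tau |-> A : grad tau is therefore a parameter
   Agrad, subject to the conventions collected in A_grad_operator below; results hold for every
   such operator.  Where A : grad tau is not an L^2 function, the value Agrad tau may be any
   function outside L^2(Om). *)
definition Qspace ::
  "(real^'n::finite) set \<Rightarrow> ((real^'n \<Rightarrow> real^'n) \<Rightarrow> real^'n \<Rightarrow> real) \<Rightarrow> (real^'n \<Rightarrow> real^'n) set" where
  "Qspace \<Omega> Agrad = {\<tau> \<in> L2 \<Omega>. Agrad \<tau> \<in> L2 \<Omega>}"

(* Independence of the representative of tau is a consequence: a null function lies in H^1 with
   zero weak gradient. *)
definition A_grad_operator ::
  "(real^'n::finite) set \<Rightarrow> (real^'n \<Rightarrow> real^'n^'n) \<Rightarrow>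
   ((real^'n \<Rightarrow> real^'n) \<Rightarrow> real^'n \<Rightarrow> real) \<Rightarrow> bool" where
  "A_grad_operator \<Omega> A Agrad \<longleftrightarrow>
     (\<forall>\<tau>\<in>Qspace \<Omega> Agrad. \<forall>\<rho>\<in>Qspace \<Omega> Agrad.
        AE x in lebesgue_on \<Omega>. Agrad (\<lambda>y. \<tau> y + \<rho> y) x = Agrad \<tau> x + Agrad \<rho> x) \<and>
     (\<forall>\<tau>\<in>Qspace \<Omega> Agrad. \<forall>c.
        AE x in lebesgue_on \<Omega>. Agrad (\<lambda>y. c *\<^sub>R \<tau> y) x = c * Agrad \<tau> x) \<and>
     (\<forall>\<tau>\<in>vec_space (H1 \<Omega>).
        AE x in lebesgue_on \<Omega>. Agrad \<tau> x = frob (A x) (wjacobian \<Omega> \<tau> x))"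

definition A_hess ::
  "(real^'n::finite) set \<Rightarrow> ((real^'n \<Rightarrow> real^'n) \<Rightarrow> real^'n \<Rightarrow> real) \<Rightarrow>
   (real^'n \<Rightarrow> real) \<Rightarrow> real^'n \<Rightarrow> real" where
  "A_hess \<Omega> Agrad v = Agrad (wgrad \<Omega> v)"

definition Vspace ::
  "(real^'n::finite) set \<Rightarrow> ((real^'n \<Rightarrow> real^'n) \<Rightarrow> real^'n \<Rightarrow> real) \<Rightarrow> (real^'n \<Rightarrow> real) set" where
  "Vspace \<Omega> Agrad = {v \<in> H10 \<Omega>. A_hess \<Omega> Agrad v \<in> L2 \<Omega>}"

definition solves_nondiv ::
  "(real^'n::finite) set \<Rightarrow> ((real^'n \<Rightarrow> real^'n) \<Rightarrow> real^'n \<Rightarrow> real) \<Rightarrow>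
   (real^'n \<Rightarrow> real) \<Rightarrow> (real^'n \<Rightarrow> real) \<Rightarrow> bool" where
  "solves_nondiv \<Omega> Agrad g v \<longleftrightarrow>
     v \<in> Vspace \<Omega> Agrad \<and> (AE x in lebesgue_on \<Omega>. - A_hess \<Omega> Agrad v x = g x)"

definition uniquely_solvable ::
  "(real^'n::finite) set \<Rightarrow> ((real^'n \<Rightarrow> real^'n) \<Rightarrow> real^'n \<Rightarrow> real) \<Rightarrow> bool" where
  "uniquely_solvable \<Omega> Agrad \<longleftrightarrow>
     (\<forall>g\<in>L2 \<Omega>. (\<exists>v. solves_nondiv \<Omega> Agrad g v) \<and>
        (\<forall>v w. solves_nondiv \<Omega> Agrad g v \<longrightarrow> solves_nondiv \<Omega> Agrad g w \<longrightarrow>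
               (AE x in lebesgue_on \<Omega>. v x = w x)))"

(* The library's polytope is convex; domains are not required to be.  Taking the interior of the
   (compact) union makes the domain open and bounded and excludes slits. *)
definition open_polytope :: "'a::euclidean_space set \<Rightarrow> bool" where
  "open_polytope \<Omega> \<longleftrightarrow>
     (\<exists>\<P>. finite \<P> \<and> (\<forall>P\<in>\<P>. polytope P) \<and> \<Omega> = interior (\<Union>\<P>))"

definition simplicial_mesh :: "(real^'n::finite) set \<Rightarrow> (real^'n) set set \<Rightarrow> bool" where
  "simplicial_mesh \<Omega> \<T> \<longleftrightarrow>
     triangulation \<T> \<and> (\<forall>K\<in>\<T>. int CARD('n) simplex K) \<and> \<Union>\<T> = closure \<Omega>"

definition inball_diameter :: "'a::euclidean_space set \<Rightarrow> real" where
  "inball_diameter K = Sup {2 * r | r. 0 \<le> r \<and> (\<exists>x. cball x r \<subseteq> K)}"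

definition shape_regular :: "real \<Rightarrow> 'a::euclidean_space set set \<Rightarrow> bool" where
  "shape_regular \<kappa> \<T> \<longleftrightarrow> (\<forall>K\<in>\<T>. diameter K / inball_diameter K \<le> \<kappa>)"

definition Pk :: "nat \<Rightarrow> (real^'n::finite \<Rightarrow> real) set" where
  "Pk k = {p. \<exists>c :: ('n \<Rightarrow> nat) \<Rightarrow> real.
      p = (\<lambda>x. \<Sum>\<alpha> | (\<Sum>i\<in>UNIV. \<alpha> i) \<le> k. c \<alpha> * (\<Prod>i\<in>UNIV. x $ i ^ \<alpha> i))}"

definition Sk :: "(real^'n::finite) set \<Rightarrow> (real^'n) set set \<Rightarrow> nat \<Rightarrow> (real^'n \<Rightarrow> real) set" where
  "Sk \<Omega> \<T> k = {v \<in> H1 \<Omega>. \<forall>K\<in>\<T>. \<exists>p\<in>Pk k. AE x in lebesgue_on K. v x = p x}"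

definition Sk0 :: "(real^'n::finite) set \<Rightarrow> (real^'n) set set \<Rightarrow> nat \<Rightarrow> (real^'n \<Rightarrow> real) set" where
  "Sk0 \<Omega> \<T> k = Sk \<Omega> \<T> k \<inter> H10 \<Omega>"

definition J\<^sub>h ::
  "(real^'n::finite) set \<Rightarrow> (real^'n) set set \<Rightarrow> ((real^'n \<Rightarrow> real^'n) \<Rightarrow> real^'n \<Rightarrow> real) \<Rightarrow>
   (real^'n \<Rightarrow> real) \<Rightarrow> (real^'n \<Rightarrow> real) \<times> (real^'n \<Rightarrow> real^'n) \<Rightarrow> real" where
  "J\<^sub>h \<Omega> \<T> Agrad f = (\<lambda>(v, \<tau>).
     (\<Sum>K\<in>\<T>. (diameter K)\<^sup>2 * (L2norm K (\<lambda>x. f x + Agrad \<tau> x))\<^sup>2)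
     + (L2norm \<Omega> (\<lambda>x. \<tau> x - wgrad \<Omega> v x))\<^sup>2)"

definition J\<^sub>0 ::
  "(real^'n::finite) set \<Rightarrow> ((real^'n \<Rightarrow> real^'n) \<Rightarrow> real^'n \<Rightarrow> real) \<Rightarrow>
   (real^'n \<Rightarrow> real) \<Rightarrow> (real^'n \<Rightarrow> real) \<times> (real^'n \<Rightarrow> real^'n) \<Rightarrow> real" where
  "J\<^sub>0 \<Omega> Agrad f = (\<lambda>(v, \<tau>).
     (L2norm \<Omega> (\<lambda>x. f x + Agrad \<tau> x))\<^sup>2 + (L2norm \<Omega> (\<lambda>x. \<tau> x - wgrad \<Omega> v x))\<^sup>2)"

definition triple_norm\<^sub>h ::
  "(real^'n::finite) set \<Rightarrow> (real^'n) set set \<Rightarrow> ((real^'n \<Rightarrow> real^'n) \<Rightarrow> real^'n \<Rightarrow> real) \<Rightarrow>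
   (real^'n \<Rightarrow> real) \<times> (real^'n \<Rightarrow> real^'n) \<Rightarrow> real" where
  "triple_norm\<^sub>h \<Omega> \<T> Agrad = (\<lambda>(v, \<tau>). sqrt
     ((\<Sum>K\<in>\<T>. (diameter K)\<^sup>2 * (L2norm K (Agrad \<tau>))\<^sup>2)
      + (L2norm \<Omega> (\<lambda>x. \<tau> x - wgrad \<Omega> v x))\<^sup>2))"

definition triple_norm\<^sub>0 ::
  "(real^'n::finite) set \<Rightarrow> ((real^'n \<Rightarrow> real^'n) \<Rightarrow> real^'n \<Rightarrow> real) \<Rightarrow>
   (real^'n \<Rightarrow> real) \<times> (real^'n \<Rightarrow> real^'n) \<Rightarrow> real" where
  "triple_norm\<^sub>0 \<Omega> Agrad = (\<lambda>(v, \<tau>). sqrt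
     ((L2norm \<Omega> (Agrad \<tau>))\<^sup>2 + (L2norm \<Omega> (\<lambda>x. \<tau> x - wgrad \<Omega> v x))\<^sup>2))"

definition minimizes_over :: "('a \<Rightarrow> real) \<Rightarrow> 'a set \<Rightarrow> 'a \<Rightarrow> bool" where
  "minimizes_over J X = is_arg_min J (\<lambda>y. y \<in> X)"

end

theory Submission
  imports Defs
begin

text \<open>
  At the exact solution \<open>f = - A : \<nabla>\<sigma>\<close> and \<open>\<sigma> = \<nabla>u\<close>, so by linearity the least-squares functional at
  a discrete pair \<open>(v, \<tau>)\<close> is the squared triple norm of the error \<open>(u - v, \<sigma> - \<tau>)\<close>. Minimizing the
  functional is therefore minimizing the error. That the continuous minimizer is exact follows
  because solvability makes the minimum value 0. Linearity of the weak gradient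
  up to null sets needs its uniqueness, which rests on the fundamental lemma of the calculus of
  variations: smooth bumps converge to the indicators of boxes.
\<close>

subsection \<open>Square-integrable functions\<close>

text \<open>What makes the argument long is the bookkeeping of null sets. Elements of the spaces are
  plain functions, \<open>wgrad\<close> is a choice among weak gradients, and \<open>Agrad\<close>
  is known only through a.e. identities, so neither operation respects a.e. equality by
  construction. Yet \<sigma> equals the gradient of \<open>u\<close> only a.e., and it has to be
  exchanged for it under \<open>Agrad\<close>. A second source of null sets is the mesh: its
  simplices are closed while \<Omega> is open, and the integrals run over whole simplices. Defining
  the polytope as the interior of a closed union keeps the excess of a simplex over \<Omega> inside
  the frontier of that simplex.\<close>

lemma borel_measurable_lebesgue_on_AE:
  fixes f g :: "'a::euclidean_space \<Rightarrow> 'b::euclidean_space"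
  assumes f: "f \<in> borel_measurable (lebesgue_on S)" and S: "S \<in> sets lebesgue"
    and ae: "AE x in lebesgue_on S. f x = g x"
  shows "g \<in> borel_measurable (lebesgue_on S)"
proof -
  \<comment> \<open>Extension by zero moves the claim to Lebesgue measure on the whole space, whose
    completeness allows changes on a null set.\<close>
  have "AE x in lebesgue. (if x \<in> S then f x else 0) = (if x \<in> S then g x else 0)"
    using ae S by (auto simp: AE_restrict_space_iff elim: eventually_mono)
  with borel_measurable_if_I[OF f S] have "(\<lambda>x. if x \<in> S then g x else 0) \<in> borel_measurable lebesgue"
    by (rule borel_measurable_AE)
  then show ?thesis
    by (simp add: borel_measurable_if[OF S])
qed

lemma L2_measurable: "f \<in> L2 \<Omega> \<Longrightarrow> f \<in> borel_measurable (lebesgue_on \<Omega>)"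
  by (simp add: L2_def)

lemma L2_cong_AE:
  assumes f: "f \<in> L2 \<Omega>" and S: "\<Omega> \<in> sets lebesgue" and ae: "AE x in lebesgue_on \<Omega>. f x = g x"
  shows "g \<in> L2 \<Omega>"
proof -
  have g: "g \<in> borel_measurable (lebesgue_on \<Omega>)"
    using L2_measurable[OF f] S ae by (rule borel_measurable_lebesgue_on_AE)
  have "integrable (lebesgue_on \<Omega>) (\<lambda>x. (norm (g x))\<^sup>2) \<longleftrightarrow>
        integrable (lebesgue_on \<Omega>) (\<lambda>x. (norm (f x))\<^sup>2)"
    using ae L2_measurable[OF f] g by (intro integrable_cong_AE) auto
  with f g show ?thesis by (simp add: L2_def)
qed

lemma L2_bound:
  assumes g: "g \<in> L2 \<Omega>" and f: "f \<in> borel_measurable (lebesgue_on \<Omega>)"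
    and le: "AE x in lebesgue_on \<Omega>. norm (f x) \<le> C * norm (g x)"
  shows "f \<in> L2 \<Omega>"
proof -
  have "integrable (lebesgue_on \<Omega>) (\<lambda>x. (norm (f x))\<^sup>2)"
  proof (rule Bochner_Integration.integrable_bound)
    show "integrable (lebesgue_on \<Omega>) (\<lambda>x. C\<^sup>2 * (norm (g x))\<^sup>2)"
      using g by (simp add: L2_def)
    show "AE x in lebesgue_on \<Omega>. norm ((norm (f x))\<^sup>2) \<le> norm (C\<^sup>2 * (norm (g x))\<^sup>2)"
      using le
    proof eventually_elim
      case (elim x)
      then have "(norm (f x))\<^sup>2 \<le> (C * norm (g x))\<^sup>2"
        by (intro power_mono) auto
      then show ?case by (simp add: power_mult_distrib)
    qed
  qed (use f in measurable)
  with f show ?thesis by (simp add: L2_def)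
qed

lemma L2_add:
  assumes f: "f \<in> L2 \<Omega>" and g: "g \<in> L2 \<Omega>"
  shows "(\<lambda>x. f x + g x) \<in> L2 \<Omega>"
proof -
  note [measurable] = f[THEN L2_measurable] g[THEN L2_measurable]
  have "integrable (lebesgue_on \<Omega>) (\<lambda>x. (norm (f x + g x))\<^sup>2)"
  proof (rule Bochner_Integration.integrable_bound)
    show "integrable (lebesgue_on \<Omega>) (\<lambda>x. 2 * (norm (f x))\<^sup>2 + 2 * (norm (g x))\<^sup>2)"
      using f g by (simp add: L2_def)
    have "(norm (f x + g x))\<^sup>2 \<le> 2 * (norm (f x))\<^sup>2 + 2 * (norm (g x))\<^sup>2" for x
    proof -
      have "(norm (f x + g x))\<^sup>2 \<le> (norm (f x) + norm (g x))\<^sup>2"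
        by (intro power_mono norm_triangle_ineq) auto
      also have "\<dots> \<le> 2 * (norm (f x))\<^sup>2 + 2 * (norm (g x))\<^sup>2"
        using zero_le_power2[of "norm (f x) - norm (g x)"] by (simp add: power2_sum power2_diff)
      finally show ?thesis .
    qed
    then show "AE x in lebesgue_on \<Omega>. norm ((norm (f x + g x))\<^sup>2)
        \<le> norm (2 * (norm (f x))\<^sup>2 + 2 * (norm (g x))\<^sup>2)"
      by simp
  qed measurable
  then show ?thesis by (simp add: L2_def)
qed

lemma L2_scaleR: "f \<in> L2 \<Omega> \<Longrightarrow> (\<lambda>x. c *\<^sub>R f x) \<in> L2 \<Omega>"
  by (auto simp: L2_def power_mult_distrib)

lemma L2_minus: "f \<in> L2 \<Omega> \<Longrightarrow> (\<lambda>x. - f x) \<in> L2 \<Omega>"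
  by (auto simp: L2_def)

lemma L2_diff: "f \<in> L2 \<Omega> \<Longrightarrow> g \<in> L2 \<Omega> \<Longrightarrow> (\<lambda>x. f x - g x) \<in> L2 \<Omega>"
  using L2_add[OF _ L2_minus] by fastforce

lemma L2_zero: "(\<lambda>x. 0) \<in> L2 \<Omega>"
  by (simp add: L2_def)

lemma L2_sum: "(\<And>i. i \<in> I \<Longrightarrow> f i \<in> L2 \<Omega>) \<Longrightarrow> (\<lambda>x. \<Sum>i\<in>I. f i x) \<in> L2 \<Omega>"
  by (induction I rule: infinite_finite_induct) (auto intro: L2_add L2_zero)

lemma L2_vec_nth:
  fixes f :: "'a::euclidean_space \<Rightarrow> real^'n::finite"
  assumes "f \<in> L2 \<Omega>"
  shows "(\<lambda>x. f x $ i) \<in> L2 \<Omega>"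
proof -
  have "(\<lambda>x. f x $ i) \<in> borel_measurable (lebesgue_on \<Omega>)"
    using L2_measurable[OF assms]
    by (rule measurable_compose) (intro borel_measurable_continuous_onI continuous_intros)
  with assms show ?thesis
    by (rule L2_bound[where C = 1]) (simp add: component_le_norm_cart)
qed

text \<open>Young's inequality suffices: 2|ab| \<le> a^2 + b^2, and one of the two copies of |ab| is
  dropped.\<close>

lemma L2_integrable_mult:
  fixes f g :: "'a::euclidean_space \<Rightarrow> real"
  assumes f: "f \<in> L2 \<Omega>" and g: "g \<in> L2 \<Omega>"
  shows "integrable (lebesgue_on \<Omega>) (\<lambda>x. f x * g x)"
proof (rule Bochner_Integration.integrable_bound)
  note [measurable] = f[THEN L2_measurable] g[THEN L2_measurable]
  show "(\<lambda>x. f x * g x) \<in> borel_measurable (lebesgue_on \<Omega>)"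
    by measurable
  show "integrable (lebesgue_on \<Omega>) (\<lambda>x. (norm (f x))\<^sup>2 + (norm (g x))\<^sup>2)"
    using f g by (simp add: L2_def)
  have "\<bar>a * b\<bar> \<le> a\<^sup>2 + b\<^sup>2" for a b :: real
    using zero_le_power2[of "\<bar>a\<bar> - \<bar>b\<bar>"]
      mult_nonneg_nonneg[of "\<bar>a\<bar>" "\<bar>b\<bar>"]
    unfolding power2_diff by (simp add: abs_mult del: mult_nonneg_nonneg)
  then show "AE x in lebesgue_on \<Omega>. norm (f x * g x) \<le> norm ((norm (f x))\<^sup>2 + (norm (g x))\<^sup>2)"
    by simp
qed

text \<open>Only the norms have to agree, because the functions compared later differ by a sign.
  Equality of norms does not carry measurability over, so that of \<open>g\<close> is
  assumed.\<close>

lemma L2norm_cong_AE: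
  assumes "f \<in> L2 \<omega>" "\<omega> \<in> sets lebesgue" "AE x in lebesgue_on \<omega>. norm (f x) = norm (g x)"
    and "g \<in> borel_measurable (lebesgue_on \<omega>)"
  shows "L2norm \<omega> f = L2norm \<omega> g"
proof -
  have "(\<integral>x. (norm (f x))\<^sup>2 \<partial>lebesgue_on \<omega>) = (\<integral>x. (norm (g x))\<^sup>2 \<partial>lebesgue_on \<omega>)"
    using assms L2_measurable[of f \<omega>] by (intro integral_cong_AE) auto
  then show ?thesis by (simp add: L2norm_def)
qed

lemma L2norm_eq_0_iff:
  assumes "f \<in> L2 \<omega>"
  shows "L2norm \<omega> f = 0 \<longleftrightarrow> (AE x in lebesgue_on \<omega>. f x = 0)"
  using assms integral_nonneg_eq_0_iff_AE[of "lebesgue_on \<omega>" "\<lambda>x. (norm (f x))\<^sup>2"]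
  by (simp add: L2norm_def L2_def)

text \<open>\<open>K\<close> may leave \<Omega>, where the values of \<open>f\<close> are arbitrary.
  The extension of \<open>f\<close> from \<Omega> by zero is square-integrable on the whole space
  and agrees with \<open>f\<close> a.e. on \<open>K\<close>.\<close>

lemma L2_subset_AE:
  fixes f :: "'a::euclidean_space \<Rightarrow> 'b::euclidean_space"
  assumes f: "f \<in> L2 \<Omega>" and sets: "\<Omega> \<in> sets lebesgue" "K \<in> sets lebesgue" and "negligible (K - \<Omega>)"
  shows "f \<in> L2 K"
proof -
  have "AE x in lebesgue. x \<notin> K - \<Omega>"
    using \<open>negligible (K - \<Omega>)\<close> unfolding negligible_iff_null_sets by (rule AE_not_in)
  then have ae: "AE x in lebesgue_on K. (if x \<in> \<Omega> then f x else 0) = f x"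
    using sets by (simp add: AE_restrict_space_iff) (erule eventually_mono, auto)
  let ?g = "\<lambda>x. if x \<in> \<Omega> then f x else 0"
  have "?g \<in> borel_measurable lebesgue"
    using L2_measurable[OF f] sets by (intro borel_measurable_if_I)
  then have g: "?g \<in> borel_measurable (lebesgue_on K)"
    by (rule measurable_restrict_space1)
  have "(\<lambda>x. if x \<in> \<Omega> then (norm (f x))\<^sup>2 else 0) = (\<lambda>x. (norm (?g x))\<^sup>2)"
    by auto
  moreover have "integrable lebesgue (\<lambda>x. if x \<in> \<Omega> then (norm (f x))\<^sup>2 else 0)"
    using f sets by (subst Lebesgue_Measure.integrable_restrict_UNIV) (auto simp: L2_def)
  ultimately have "integrable lebesgue (\<lambda>x. (norm (?g x))\<^sup>2)"
    by simp
  then have "integrable (lebesgue_on K) (\<lambda>x. (norm (?g x))\<^sup>2)"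
    using sets integrable_mult_indicator[of K lebesgue "\<lambda>x. (norm (?g x))\<^sup>2"]
    by (simp add: integrable_restrict_space)
  with g have "?g \<in> L2 K" by (simp add: L2_def)
  then show ?thesis using sets(2) ae by (rule L2_cong_AE)
qed

lemma Linfty_mult_L2:
  fixes a f :: "'a::euclidean_space \<Rightarrow> real"
  assumes a: "a \<in> Linfty \<Omega>" and f: "f \<in> L2 \<Omega>"
  shows "(\<lambda>x. a x * f x) \<in> L2 \<Omega>"
proof -
  obtain M where M: "AE x in lebesgue_on \<Omega>. norm (a x) \<le> M"
    using a by (auto simp: Linfty_def)
  have [measurable]: "a \<in> borel_measurable (lebesgue_on \<Omega>)" "f \<in> borel_measurable (lebesgue_on \<Omega>)"
    using a f by (auto simp: Linfty_def L2_def)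
  show ?thesis
    using f
  proof (rule L2_bound)
    show "AE x in lebesgue_on \<Omega>. norm (a x * f x) \<le> M * norm (f x)"
      using M by eventually_elim (simp add: abs_mult mult_right_mono)
  qed measurable
qed

lemma Linfty_vec_nth:
  fixes A :: "'a::euclidean_space \<Rightarrow> real^'n::finite^'m::finite"
  assumes "A \<in> Linfty \<Omega>"
  shows "(\<lambda>x. A x $ i $ j) \<in> Linfty \<Omega>"
proof -
  obtain M where "AE x in lebesgue_on \<Omega>. norm (A x) \<le> M"
    using assms by (auto simp: Linfty_def)
  then have "AE x in lebesgue_on \<Omega>. norm (A x $ i $ j) \<le> M"
  proof eventually_elim
    case (elim x)
    then show ?case
      using Finite_Cartesian_Product.norm_nth_le[of "A x $ i" j] Finite_Cartesian_Product.norm_nth_le[of "A x" i]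
      by linarith
  qed
  moreover have "(\<lambda>x. A x $ i $ j) \<in> borel_measurable (lebesgue_on \<Omega>)"
    using assms
    by (intro measurable_compose[of A _ borel "\<lambda>B. B $ i $ j"] borel_measurable_continuous_onI continuous_intros)
      (auto simp: Linfty_def)
  ultimately show ?thesis by (auto simp: Linfty_def)
qed

subsection \<open>Smooth bump functions\<close>

lemma Ck_imp_continuous_on: "Ck m \<phi> \<Longrightarrow> continuous_on UNIV \<phi>"
  by (cases m) (auto simp: continuous_on_eq_continuous_at differentiable_imp_continuous_within)

lemma Ck_Suc_imp_Ck: "Ck (Suc m) \<phi> \<Longrightarrow> Ck m \<phi>"
proof (induction m arbitrary: \<phi>)
  case 0
  then show ?case
    using Ck_imp_continuous_on by (metis Ck.simps(1))
qed auto

lemma partial_add: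
  assumes "\<And>x. \<phi> differentiable (at x)" "\<And>x. \<psi> differentiable (at x)"
  shows "partial j (\<lambda>x. \<phi> x + \<psi> x) = (\<lambda>x. partial j \<phi> x + partial j \<psi> x)"
proof
  fix x
  have "((\<lambda>x. \<phi> x + \<psi> x) has_derivative
      (\<lambda>h. frechet_derivative \<phi> (at x) h + frechet_derivative \<psi> (at x) h)) (at x)"
    by (intro has_derivative_add assms[THEN frechet_derivative_works[THEN iffD1]])
  from frechet_derivative_at[OF this, symmetric]
  show "partial j (\<lambda>x. \<phi> x + \<psi> x) x = partial j \<phi> x + partial j \<psi> x"
    by (simp add: partial_def)
qed

lemma partial_mult:
  assumes "\<And>x. \<phi> differentiable (at x)" "\<And>x. \<psi> differentiable (at x)"
  shows "partial j (\<lambda>x. \<phi> x * \<psi> x) = (\<lambda>x. \<phi> x * partial j \<psi> x + partial j \<phi> x * \<psi> x)"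
proof
  fix x
  have "((\<lambda>x. \<phi> x * \<psi> x) has_derivative
      (\<lambda>h. \<phi> x * frechet_derivative \<psi> (at x) h + frechet_derivative \<phi> (at x) h * \<psi> x)) (at x)"
    by (intro has_derivative_mult assms[THEN frechet_derivative_works[THEN iffD1]])
  from frechet_derivative_at[OF this, symmetric]
  show "partial j (\<lambda>x. \<phi> x * \<psi> x) x = \<phi> x * partial j \<psi> x + partial j \<phi> x * \<psi> x"
    by (simp add: partial_def)
qed

lemma Ck_add: "Ck m \<phi> \<Longrightarrow> Ck m \<psi> \<Longrightarrow> Ck m (\<lambda>x. \<phi> x + \<psi> x)"
  by (induction m arbitrary: \<phi> \<psi>) (auto simp: partial_add intro: continuous_on_add)

lemma Ck_mult: "Ck m \<phi> \<Longrightarrow> Ck m \<psi> \<Longrightarrow> Ck m (\<lambda>x. \<phi> x * \<psi> x)"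
proof (induction m arbitrary: \<phi> \<psi>)
  case 0
  then show ?case by (auto intro: continuous_on_mult)
next
  case (Suc m)
  \<comment> \<open>The product rule leaves one factor undifferentiated, and the induction
    hypothesis asks for that factor in \<open>Ck m\<close>.\<close>
  have "Ck m \<phi>" "Ck m \<psi>"
    using Suc.prems by (auto intro: Ck_Suc_imp_Ck)
  with Suc.prems show ?case
    by (auto simp: partial_mult intro!: Ck_add Suc.IH)
qed

lemma Ck_const: "Ck m (\<lambda>x. c)"
proof (induction m arbitrary: c)
  case (Suc m)
  have "partial j (\<lambda>x. c) = (\<lambda>x. 0)" for j :: 'a
    by (simp add: partial_def fun_eq_iff)
  with Suc show ?case by simp
qed simp

lemma Ck_prod:
  assumes "finite I" "\<And>i. i \<in> I \<Longrightarrow> Ck m (\<phi> i)"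
  shows "Ck m (\<lambda>x. \<Prod>i\<in>I. \<phi> i x)"
  using assms by (induction I) (auto intro: Ck_mult Ck_const)

text \<open>This class contains \<open>exp (- 1 / t)\<close> (extended by 0) and is closed under differentiation.\<close>

definition flat_fun :: "real poly \<Rightarrow> real \<Rightarrow> real" where
  "flat_fun p t = (if 0 < t then poly p (1 / t) * exp (- (1 / t)) else 0)"

lemma tendsto_poly_mult_exp_minus: "((\<lambda>s::real. poly p s * exp (- s)) \<longlongrightarrow> 0) at_top"
proof -
  have "((\<lambda>s. \<Sum>i\<le>degree p. coeff p i * (s ^ i / exp s)) \<longlongrightarrow> 0) at_top"
    by (intro tendsto_null_sum tendsto_mult_right_zero tendsto_power_div_exp_0)
  then show ?thesis
    by (simp add: poly_altdef sum_distrib_right exp_minus divide_inverse mult.assoc)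
qed

text \<open>With s = 1/t the derivative in t is -s^2 times the derivative in s, which turns p(s)
  exp(-s) into s^2 (p(s) - p'(s)) exp(-s); \<open>[:0, 0, 1:]\<close> is the polynomial s^2. At t =
  0 the difference quotients from both sides tend to 0.\<close>

lemma DERIV_flat_fun:
  "(flat_fun p has_real_derivative flat_fun ((p - pderiv p) * [:0, 0, 1:]) t) (at t)"
proof (cases t "0::real" rule: linorder_cases)
  case less
  have "(flat_fun p has_real_derivative 0) (at t) \<longleftrightarrow> ((\<lambda>t. 0) has_real_derivative 0) (at t)"
    using less
    by (intro DERIV_cong_ev refl) (auto simp: flat_fun_def eventually_nhds intro!: exI[of _ "{..<0}"])
  with less show ?thesis by (simp add: flat_fun_def)
next
  case greater
  have "(flat_fun p has_real_derivative D) (at t) \<longleftrightarrow>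
        ((\<lambda>t. poly p (1 / t) * exp (- (1 / t))) has_real_derivative D) (at t)" for D
    using greater
    by (intro DERIV_cong_ev refl) (auto simp: flat_fun_def eventually_nhds intro!: exI[of _ "{0<..}"])
  moreover have "((\<lambda>t. poly p (1 / t) * exp (- (1 / t))) has_real_derivative
      flat_fun ((p - pderiv p) * [:0, 0, 1:]) t) (at t)"
    using greater
    by (auto intro!: derivative_eq_intros DERIV_chain2[OF poly_DERIV]
        simp: flat_fun_def field_simps power2_eq_square)
  ultimately show ?thesis by simp
next
  case equal
  \<comment> \<open>With s = 1/h the quotient \<open>flat_fun p h / h\<close> is s p(s) exp(-s), and
    \<open>pCons 0 p\<close> is the polynomial s p(s).\<close>
  have "((\<lambda>s. poly (pCons 0 p) s * exp (- s)) \<longlongrightarrow> 0) at_top"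
    by (rule tendsto_poly_mult_exp_minus)
  then have "((\<lambda>h. poly (pCons 0 p) (inverse h) * exp (- inverse h)) \<longlongrightarrow> 0) (at_right 0)"
    by (rule filterlim_compose) (rule filterlim_inverse_at_top_right)
  then have right: "((\<lambda>h. flat_fun p h / h) \<longlongrightarrow> 0) (at_right 0)"
    by (rule Lim_transform_eventually)
      (auto simp: eventually_at_right_field flat_fun_def field_simps intro!: exI[of _ 1])
  have left: "((\<lambda>h. flat_fun p h / h) \<longlongrightarrow> 0) (at_left 0)"
    by (rule Lim_transform_eventually[OF tendsto_const])
      (auto simp: eventually_at_left_field flat_fun_def intro!: exI[of _ "-1"])
  have "((\<lambda>h. flat_fun p h / h) \<longlongrightarrow> 0) (at 0)"
    using left right by (rule filterlim_split_at)
  with equal show ?thesis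
    by (simp add: has_field_derivative_iff flat_fun_def)
qed

text \<open>A partial derivative is a constant times a function of the same form for another
  polynomial, hence the induction with \<open>p\<close> arbitrary. The coefficient \<open>c\<close>
  may have either sign, which serves both the lower and the upper faces of a box.\<close>

lemma Ck_flat_fun: "Ck m (\<lambda>x::real^'n::finite. flat_fun p (c * x $ i + d))"
proof (induction m arbitrary: p)
  case 0
  have "continuous_on UNIV (flat_fun p)"
    using DERIV_flat_fun by (intro DERIV_continuous_on) auto
  then show ?case
    by (auto intro!: continuous_on_compose2[of UNIV "flat_fun p"] continuous_intros)
next
  case (Suc m)
  let ?q = "(p - pderiv p) * [:0, 0, 1:]"
  have der: "((\<lambda>x::real^'n. flat_fun p (c * x $ i + d)) has_derivative
      (\<lambda>h. flat_fun ?q (c * x $ i + d) * (c * h $ i))) (at x)" for x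
  proof -
    have "(flat_fun p has_derivative (\<lambda>h. flat_fun ?q (c * x $ i + d) * h)) (at (c * x $ i + d))"
      using DERIV_flat_fun by (simp add: has_field_derivative_def)
    moreover have "((\<lambda>x::real^'n. c * x $ i + d) has_derivative (\<lambda>h. c * h $ i)) (at x)"
      by (auto intro!: derivative_eq_intros bounded_linear_imp_has_derivative bounded_linear_vec_nth)
    ultimately show ?thesis
      using has_derivative_compose[where f = "\<lambda>x::real^'n. c * x $ i + d" and g = "flat_fun p"] by blast
  qed
  have "partial j (\<lambda>x::real^'n. flat_fun p (c * x $ i + d)) =
      (\<lambda>x. flat_fun ?q (c * x $ i + d) * (c * axis j 1 $ i))" for j
    using frechet_derivative_at[OF der, symmetric] by (simp add: partial_def fun_eq_iff)
  moreover have "(\<lambda>x::real^'n. flat_fun p (c * x $ i + d)) differentiable (at x)" for x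
    using der differentiable_def by blast
  ultimately show ?case
    by (simp only: Ck.simps) (auto intro!: Ck_mult Ck_const Suc.IH)
qed

text \<open>Each coordinate contributes exp(-1/(c s)) for the distances s to its two faces. Raising
  c > 0 lifts the bump towards 1 inside the box and leaves its support unchanged, so this explicit
  family does the work of mollified indicators.\<close>

definition box_bump :: "real \<Rightarrow> real^'n::finite \<Rightarrow> real^'n \<Rightarrow> real^'n \<Rightarrow> real" where
  "box_bump c a b x =
     (\<Prod>i\<in>UNIV. flat_fun 1 (c * (x $ i - a $ i)) * flat_fun 1 (c * (b $ i - x $ i)))"

lemma flat_fun_1_bounds: "0 \<le> flat_fun 1 t" "flat_fun 1 t \<le> 1"
  by (auto simp: flat_fun_def)

lemma box_bump_bounds: "0 \<le> box_bump c a b x" "box_bump c a b x \<le> 1"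
  by (auto simp: box_bump_def intro!: prod_nonneg prod_le_1 mult_le_one mult_nonneg_nonneg flat_fun_1_bounds)

lemma box_bump_nonzero_iff:
  assumes "0 < c"
  shows "box_bump c a b x \<noteq> 0 \<longleftrightarrow> x \<in> box a b"
  using assms by (auto simp: box_bump_def flat_fun_def mem_box_cart zero_less_mult_iff)

text \<open>Inside the box every exponent is a constant divided by \<open>Suc n\<close>; outside,
  the bump is 0 for every n. The successor keeps the scale positive, since at scale 0 the bump
  vanishes identically.\<close>

lemma box_bump_tendsto_indicator:
  "(\<lambda>n. box_bump (real (Suc n)) a b x) \<longlonglongrightarrow> indicator (box a b) x"
proof (cases "x \<in> box a b")
  case True
  have lim: "(\<lambda>n. flat_fun 1 (real (Suc n) * t)) \<longlonglongrightarrow> 1" if "0 < t" for t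
  proof -
    have "(\<lambda>n. exp (- (1 / t * inverse (real (Suc n))))) \<longlonglongrightarrow> exp (- (1 / t * 0))"
      by (intro tendsto_intros LIMSEQ_inverse_real_of_nat)
    then show ?thesis
      using that by (simp add: flat_fun_def divide_simps mult.commute)
  qed
  have "(\<lambda>n. box_bump (real (Suc n)) a b x) \<longlonglongrightarrow> (\<Prod>i\<in>(UNIV::'a set). 1 * 1)"
    unfolding box_bump_def using True
    by (intro tendsto_prod tendsto_mult lim) (auto simp: mem_box_cart)
  with True show ?thesis by simp
next
  case False
  then have "box_bump (real (Suc n)) a b x = 0" for n
    using box_bump_nonzero_iff[of "real (Suc n)" a b x] by auto
  with False show ?thesis by simp
qed

lemma box_bump_test_function:
  assumes "0 < c" "cbox a b \<subseteq> \<Omega>"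
  shows "box_bump c a b \<in> test_functions \<Omega>"
proof -
  have "Ck m (box_bump c a b)" for m
  proof -
    have "box_bump c a b = (\<lambda>x. \<Prod>i\<in>UNIV. flat_fun 1 (c * x $ i + (- c * a $ i)) *
        flat_fun 1 (- c * x $ i + c * b $ i))"
      by (simp add: box_bump_def fun_eq_iff algebra_simps)
    then show ?thesis
      by (simp only:) (intro Ck_prod Ck_mult Ck_flat_fun finite)
  qed
  moreover have "closure {x. box_bump c a b x \<noteq> 0} \<subseteq> cbox a b"
    using assms by (intro closure_minimal) (auto simp: box_bump_nonzero_iff box_subset_cbox[THEN subsetD])
  moreover have "compact (closure {x. box_bump c a b x \<noteq> 0})"
    using assms(1) bounded_box by (simp add: compact_closure box_bump_nonzero_iff)
  ultimately show ?thesis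
    using assms by (auto simp: test_functions_def)
qed

subsection \<open>The fundamental lemma of the calculus of variations\<close>

text \<open>A Dynkin argument: boxes are stable under intersection and generate the Borel sets, and
  the sets over which the integral vanishes are closed under complements and countable disjoint
  unions. An integrable function whose integral over every Borel set is 0 is a density equal to 0
  a.e.\<close>

lemma AE_zero_if_box_integrals_zero:
  fixes h :: "'a::euclidean_space \<Rightarrow> real"
  assumes h: "integrable lebesgue h" and box: "\<And>a b. (LINT x:box a b|lebesgue. h x) = 0"
  shows "AE x in lebesgue. h x = 0"
proof -
  have "h \<in> borel_measurable lebesgue"
    using h by auto
  \<comment> \<open>Boxes generate only the Borel sets, so a Borel representative is used;
    completion leads back to Lebesgue measure at the end.\<close>
  then obtain g where g: "g \<in> borel_measurable lborel" and hg: "AE x in lborel. h x = g x"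
    using completion_ex_borel_measurable_real by blast
  have g'[measurable]: "g \<in> borel_measurable lebesgue"
    using g by (rule measurable_completion)
  have hg': "AE x in lebesgue. h x = g x"
    using hg by (rule AE_completion)
  have "integrable lebesgue g"
    using h hg' g' by (subst integrable_cong_AE[of _ _ h]) auto
  then have int: "integrable lborel g"
    using g by (simp add: integrable_completion)
  have set_int: "set_integrable lborel A g" if "A \<in> sets borel" for A
    using integrable_mult_indicator[OF _ int, of A] that by (simp add: set_integrable_def)
  have g_box: "(LINT x:box a b|lborel. g x) = 0" for a b
  proof -
    have "(LINT x:box a b|lborel. g x) = (LINT x:box a b|lebesgue. g x)"
      using g unfolding set_lebesgue_integral_def by (subst integral_completion) auto
    also have "\<dots> = (LINT x:box a b|lebesgue. h x)"
      using hg' h unfolding set_lebesgue_integral_def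
      by (intro integral_cong_AE borel_measurable_scaleR borel_measurable_indicator) auto
    finally show ?thesis using box by simp
  qed
  \<comment> \<open>The complement case below needs the integral over the whole space, which is
    exhausted by centred boxes.\<close>
  have total: "(LINT x:UNIV|lborel. g x) = 0"
  proof -
    let ?B = "\<lambda>i::nat. box (- (real i *\<^sub>R One)) (real i *\<^sub>R One) :: 'a set"
    have "incseq ?B"
      by (auto simp: incseq_def mem_box) (force intro: order.strict_trans2 order.strict_trans1)+
    then have "(\<lambda>i. LINT x:?B i|lborel. g x) \<longlonglongrightarrow> (LINT x:(\<Union>i. ?B i)|lborel. g x)"
      by (intro set_integral_cont_up set_int) auto
    then have "(\<lambda>i::nat. 0::real) \<longlonglongrightarrow> (LINT x:UNIV|lborel. g x)"
      by (simp only: UN_box_eq_UNIV g_box)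
    then show ?thesis
      by (simp add: LIMSEQ_const_iff)
  qed
  have zero: "(LINT x:A|lborel. g x) = 0" if A: "A \<in> sets borel" for A
  proof -
    let ?E = "range (\<lambda>(a, b). box a b :: 'a set)"
    have borel: "sets borel = sigma_sets UNIV ?E"
      by (subst borel_eq_box) simp
    have "Int_stable ?E"
      unfolding Int_stable_def by (auto simp: box_Int_box)
    moreover have "?E \<subseteq> Pow UNIV" "A \<in> sigma_sets UNIV ?E"
      using A borel by auto
    ultimately show ?thesis
    proof (induction rule: sigma_sets_induct_disjoint)
      case (basic A)
      then show ?case using g_box by auto
    next
      case (compl A)
      then have "(LINT x:A \<union> (UNIV - A)|lborel. g x) =
          (LINT x:A|lborel. g x) + (LINT x:UNIV - A|lborel. g x)"
        by (intro set_integral_Un set_int) (auto simp flip: borel)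
      with compl total show ?case by simp
    next
      case (union A)
      then have [simp]: "A i \<in> sets borel" for i
        using borel by auto
      have "(LINT x:(\<Union>i. A i)|lborel. g x) = (\<Sum>i. LINT x:A i|lborel. g x)"
        using union
        by (intro lebesgue_integral_countable_add set_int) (auto simp: disjoint_family_on_def)
      with union show ?case by simp
    qed (simp add: set_lebesgue_integral_def)
  qed
  have "AE x in lborel. g x = 0"
    by (rule density_unique_real[OF int integrable_zero]) (use zero in \<open>auto simp: set_lebesgue_integral_def\<close>)
  then have "AE x in lborel. h x = 0"
    using hg by eventually_elim simp
  then show ?thesis by (rule AE_completion)
qed

lemma AE_lebesgue_on_iff:
  "S \<in> sets lebesgue \<Longrightarrow> (AE x in lebesgue_on S. P x) \<longleftrightarrow> (AE x in lebesgue. x \<in> S \<longrightarrow> P x)"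
  by (simp add: AE_restrict_space_iff)

lemma integrable_indicator_lebesgue_on:
  assumes "S \<in> sets lebesgue" "B \<in> lmeasurable"
  shows "integrable (lebesgue_on S) (indicator B :: 'a::euclidean_space \<Rightarrow> real)"
proof -
  have "integrable lebesgue (indicator B :: 'a \<Rightarrow> real)"
    using assms(2) by (intro integrable_real_indicator) (auto simp: fmeasurable_def)
  then show ?thesis
    using assms(1) integrable_mult_indicator[of S lebesgue "indicator B :: 'a \<Rightarrow> real"]
    by (simp add: integrable_restrict_space)
qed

text \<open>On an open set of possibly infinite measure \<open>d\<close> is square-integrable
  without being known to be integrable. On a box whose closed version lies in \<Omega> it is
  integrable and bumps are admissible tests, so \<open>d\<close> vanishes a.e. there; countably many
  closed boxes cover \<Omega>.\<close>

lemma L2_AE_zero_if_test_integrals_zero: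
  fixes d :: "real^'n::finite \<Rightarrow> real"
  assumes \<Omega>: "open \<Omega>" and d: "d \<in> L2 \<Omega>"
    and test: "\<And>\<phi>. \<phi> \<in> test_functions \<Omega> \<Longrightarrow> (\<integral>x. d x * \<phi> x \<partial>lebesgue_on \<Omega>) = 0"
  shows "AE x in lebesgue_on \<Omega>. d x = 0"
proof -
  have [simp]: "\<Omega> \<in> sets lebesgue"
    using \<Omega> by auto
  note [measurable] = L2_measurable[OF d]
  have abs_le: "\<bar>t\<bar> \<le> t\<^sup>2 + 1" for t :: real
    using zero_le_power2[of "\<bar>t\<bar> - 1"] by (simp add: power2_diff)
  have [simp]: "box a b \<in> sets (lebesgue_on \<Omega>)" if "box a b \<subseteq> \<Omega>" for a b
    using that by (simp add: sets_restrict_space_iff)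
  \<comment> \<open>By |t| \<le> t^2 + 1 this function dominates the product of \<open>d\<close>
    with any bump on the box, uniformly in the scale.\<close>
  have dom: "integrable (lebesgue_on \<Omega>) (\<lambda>x. (d x)\<^sup>2 + indicator (box a b) x)" for a b
    using d by (intro Bochner_Integration.integrable_add integrable_indicator_lebesgue_on) (auto simp: L2_def)
  have box_zero: "(\<integral>x. d x * indicator (box a b) x \<partial>lebesgue_on \<Omega>) = 0" if ab: "cbox a b \<subseteq> \<Omega>" for a b
  proof -
    have sub: "box a b \<subseteq> \<Omega>"
      using ab box_subset_cbox by blast
    let ?s = "\<lambda>n x. d x * box_bump (real (Suc n)) a b x"
    have test_bump: "box_bump (real (Suc n)) a b \<in> test_functions \<Omega>" for n
      using ab by (intro box_bump_test_function) auto
    have "(\<lambda>n. \<integral>x. ?s n x \<partial>lebesgue_on \<Omega>) \<longlonglongrightarrow> (\<integral>x. d x * indicator (box a b) x \<partial>lebesgue_on \<Omega>)"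
    proof (rule integral_dominated_convergence[OF _ _ dom])
      show "(\<lambda>x. d x * indicator (box a b) x) \<in> borel_measurable (lebesgue_on \<Omega>)"
        using sub by (intro borel_measurable_times borel_measurable_indicator) auto
      show "?s n \<in> borel_measurable (lebesgue_on \<Omega>)" for n
      proof (intro borel_measurable_times)
        have "Ck 0 (box_bump (real (Suc n)) a b)"
          using test_bump by (simp only: test_functions_def mem_Collect_eq)
        then have "box_bump (real (Suc n)) a b \<in> borel_measurable borel"
          by (intro borel_measurable_continuous_onI) simp
        then show "box_bump (real (Suc n)) a b \<in> borel_measurable (lebesgue_on \<Omega>)"
          by (intro measurable_restrict_space1 measurable_completion) simp
      qed simp
      show "AE x in lebesgue_on \<Omega>. (\<lambda>n. ?s n x) \<longlonglongrightarrow> d x * indicator (box a b) x"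
        by (intro AE_I2 tendsto_mult tendsto_const box_bump_tendsto_indicator)
      have "\<bar>?s n x\<bar> \<le> (d x)\<^sup>2 + indicator (box a b) x" for n x
      proof (cases "x \<in> box a b")
        case True
        have "\<bar>?s n x\<bar> = \<bar>d x\<bar> * box_bump (real (Suc n)) a b x"
          by (simp only: abs_mult abs_of_nonneg[OF box_bump_bounds(1)])
        also have "\<dots> \<le> \<bar>d x\<bar>"
          by (intro mult_left_le box_bump_bounds) simp
        also have "\<dots> \<le> (d x)\<^sup>2 + 1"
          by (rule abs_le)
        finally show ?thesis using True by simp
      next
        case False
        then have "box_bump (real (Suc n)) a b x = 0"
          using box_bump_nonzero_iff[of "real (Suc n)" a b x] by auto
        then show ?thesis by simp
      qed
      then show "AE x in lebesgue_on \<Omega>. norm (?s n x) \<le> (d x)\<^sup>2 + indicator (box a b) x" for n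
        by simp
    qed
    moreover have "(\<integral>x. ?s n x \<partial>lebesgue_on \<Omega>) = 0" for n
      using test_bump by (rule test)
    ultimately show ?thesis
      by (simp add: LIMSEQ_const_iff)
  qed
  have local_zero: "AE x in lebesgue. x \<in> cbox a b \<longrightarrow> d x = 0" if ab: "cbox a b \<subseteq> \<Omega>" for a b
  proof -
    have sub: "box a b \<subseteq> \<Omega>"
      using ab box_subset_cbox by blast
    let ?h = "\<lambda>x. if x \<in> \<Omega> then d x * indicator (box a b) x else 0"
    have "integrable (lebesgue_on \<Omega>) (\<lambda>x. d x * indicator (box a b) x)"
    proof (rule Bochner_Integration.integrable_bound[OF dom])
      show "(\<lambda>x. d x * indicator (box a b) x) \<in> borel_measurable (lebesgue_on \<Omega>)"
        using sub by (intro borel_measurable_times borel_measurable_indicator) auto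
      show "AE x in lebesgue_on \<Omega>. norm (d x * indicator (box a b) x)
          \<le> norm ((d x)\<^sup>2 + indicator (box a b) x)"
        using abs_le by (auto simp: indicator_def)
    qed
    then have int: "integrable lebesgue ?h"
      by (simp add: Lebesgue_Measure.integrable_restrict_UNIV)
    \<comment> \<open>The truncated function must be integrated over arbitrary boxes, but each of
      them meets \<open>box a b\<close> in a box, to which \<open>box_zero\<close> applies.\<close>
    have "(LINT x:box a' b'|lebesgue. ?h x) = 0" for a' b'
    proof -
      obtain p q where pq: "box a b \<inter> box a' b' = box p q"
        using box_Int_box[of a b a' b'] by blast
      have "(LINT x:box a' b'|lebesgue. ?h x) =
          (\<integral>x. (if x \<in> \<Omega> then d x * indicator (box p q) x else 0) \<partial>lebesgue)"
        unfolding set_lebesgue_integral_def pq[symmetric]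
        by (intro Bochner_Integration.integral_cong refl) (auto simp: indicator_def)
      also have "\<dots> = (\<integral>x. d x * indicator (box p q) x \<partial>lebesgue_on \<Omega>)"
        by (simp add: Lebesgue_Measure.integral_restrict_UNIV)
      also have "\<dots> = 0"
      \<comment> \<open>Only \<open>box p q\<close> is known. If it is empty it says nothing about
        \<open>cbox p q\<close>; otherwise \<open>cbox p q\<close> is its closure and stays in
        \<Omega>.\<close>
      proof (cases "box p q = {}")
        case False
        then have "cbox p q = closure (box p q)"
          by (simp add: closure_box)
        also have "\<dots> \<subseteq> closure (box a b)"
          unfolding pq[symmetric] by (intro closure_mono) auto
        also have "\<dots> \<subseteq> cbox a b"
          by (intro closure_minimal box_subset_cbox closed_cbox)
        finally show ?thesis
          using ab by (intro box_zero) auto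
      qed simp
      finally show ?thesis .
    qed
    then have "AE x in lebesgue. ?h x = 0"
      by (intro AE_zero_if_box_integrals_zero int) auto
    moreover have "AE x in lebesgue. x \<notin> cbox a b - box a b"
      using negligible_frontier_interval unfolding negligible_iff_null_sets by (rule AE_not_in)
    ultimately show ?thesis
      by eventually_elim (use sub in \<open>auto simp: indicator_def split: if_splits\<close>)
  qed
  obtain \<D> where \<D>: "countable \<D>" "\<D> \<subseteq> Pow \<Omega>" "\<And>X. X \<in> \<D> \<Longrightarrow> \<exists>a b. X = cbox a b" "\<Union>\<D> = \<Omega>"
    using open_countable_Union_open_cbox[OF \<Omega>] by metis
  have "AE x in lebesgue. \<forall>X\<in>\<D>. x \<in> X \<longrightarrow> d x = 0"
    using \<D>(1)
  proof (rule AE_ball_countable[THEN iffD2], intro ballI)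
    fix X assume "X \<in> \<D>"
    moreover from this obtain a b where "X = cbox a b"
      using \<D>(3) by blast
    ultimately show "AE x in lebesgue. x \<in> X \<longrightarrow> d x = 0"
      using \<D>(2) by (auto intro!: local_zero)
  qed
  then show ?thesis
    unfolding AE_lebesgue_on_iff[OF \<open>\<Omega> \<in> sets lebesgue\<close>]
    by eventually_elim (use \<D>(4) in auto)
qed

subsection \<open>Weak gradients\<close>

text \<open>The square is bounded by a multiple of the indicator of the compact support, so \<Omega>
  may have infinite measure. Square-integrable tests make the products in the weak-gradient identity
  integrable, as splitting its integrals requires.\<close>

lemma test_functions_subset_L2:
  assumes \<Omega>: "\<Omega> \<in> sets lebesgue" and \<phi>: "\<phi> \<in> test_functions \<Omega>"
  shows "\<phi> \<in> L2 \<Omega>"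
proof -
  let ?K = "closure {x. \<phi> x \<noteq> 0}"
  have K: "compact ?K" and "Ck 0 \<phi>"
    using \<phi> by (simp_all only: test_functions_def mem_Collect_eq)
  then have cont: "continuous_on UNIV \<phi>"
    by simp
  then have "bounded (\<phi> ` ?K)"
    using K by (intro compact_imp_bounded compact_continuous_image) (auto intro: continuous_on_subset)
  then obtain M where M: "\<And>x. x \<in> ?K \<Longrightarrow> norm (\<phi> x) \<le> M"
    by (auto simp: bounded_iff)
  have [measurable]: "\<phi> \<in> borel_measurable (lebesgue_on \<Omega>)"
    using cont
    by (intro measurable_restrict_space1 measurable_completion) (simp add: borel_measurable_continuous_onI)
  have "integrable (lebesgue_on \<Omega>) (\<lambda>x. (norm (\<phi> x))\<^sup>2)"
  proof (rule Bochner_Integration.integrable_bound)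
    show "integrable (lebesgue_on \<Omega>) (\<lambda>x. M\<^sup>2 * indicator ?K x)"
      using K \<Omega> by (intro integrable_mult_right integrable_indicator_lebesgue_on lmeasurable_compact)
    have "(norm (\<phi> x))\<^sup>2 \<le> M\<^sup>2 * indicator ?K x" for x
    proof (cases "x \<in> ?K")
      case True
      then show ?thesis using M[OF True] by (auto intro: power_mono simp del: real_norm_def)
    next
      case False
      then have "\<phi> x = 0" using closure_subset[of "{x. \<phi> x \<noteq> 0}"] by auto
      then show ?thesis by simp
    qed
    then show "AE x in lebesgue_on \<Omega>. norm ((norm (\<phi> x))\<^sup>2) \<le> norm (M\<^sup>2 * indicator ?K x)"
      by (intro AE_I2) (simp add: abs_mult)
  qed measurable
  then show ?thesis by (simp add: L2_def)
qed

text \<open>Off its closed support \<phi> vanishes on a neighbourhood, so differentiation cannot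
  enlarge the support.\<close>

lemma partial_test_function:
  assumes \<phi>: "\<phi> \<in> test_functions \<Omega>"
  shows "partial j \<phi> \<in> test_functions \<Omega>"
proof -
  let ?K = "closure {x. \<phi> x \<noteq> 0}"
  have K: "compact ?K" "?K \<subseteq> \<Omega>" and Ck: "\<And>m. Ck m \<phi>"
    using \<phi> by (simp_all only: test_functions_def mem_Collect_eq)
  have "Ck m (partial j \<phi>)" for m
    using Ck[of "Suc m"] by simp
  moreover have "partial j \<phi> x = 0" if "x \<notin> ?K" for x
  proof -
    have "((\<lambda>x. 0) has_derivative (\<lambda>h. 0)) (at x)"
      by simp
    then have "(\<phi> has_derivative (\<lambda>h. 0)) (at x)"
    proof (rule has_derivative_transform_within_open)
      show "open (- ?K)" "x \<in> - ?K"
        using that by auto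
      show "0 = \<phi> y" if "y \<in> - ?K" for y
        using that closure_subset[of "{x. \<phi> x \<noteq> 0}"] by auto
    qed
    from frechet_derivative_at[OF this, symmetric] show ?thesis
      by (simp add: partial_def)
  qed
  then have "closure {x. partial j \<phi> x \<noteq> 0} \<subseteq> ?K"
    by (intro closure_minimal) auto
  moreover from this have "compact (closure {x. partial j \<phi> x \<noteq> 0})"
    using K(1) by (metis bounded_subset closed_closure compact_eq_bounded_closed)
  ultimately show ?thesis
    using K(2) by (auto simp: test_functions_def)
qed

lemma is_weak_gradient_wgrad:
  assumes "v \<in> H1 \<Omega>"
  shows "is_weak_gradient \<Omega> v (wgrad \<Omega> v)"
proof -
  obtain g where "is_weak_gradient \<Omega> v g"
    using assms by (auto simp: H1_def)
  then show ?thesis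
    unfolding wgrad_def by (rule someI[of "is_weak_gradient \<Omega> v"])
qed

lemma wgrad_L2: "v \<in> H1 \<Omega> \<Longrightarrow> wgrad \<Omega> v \<in> L2 \<Omega>"
  using is_weak_gradient_wgrad by (auto simp: is_weak_gradient_def)

lemma is_weak_gradient_diff:
  assumes \<Omega>: "\<Omega> \<in> sets lebesgue" and v: "is_weak_gradient \<Omega> v g" and w: "is_weak_gradient \<Omega> w h"
  shows "is_weak_gradient \<Omega> (\<lambda>x. v x - w x) (\<lambda>x. g x - h x)"
  unfolding is_weak_gradient_def
proof (intro conjI ballI allI)
  note L2 = v[unfolded is_weak_gradient_def, THEN conjunct1]
    v[unfolded is_weak_gradient_def, THEN conjunct2, THEN conjunct1]
    w[unfolded is_weak_gradient_def, THEN conjunct1]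
    w[unfolded is_weak_gradient_def, THEN conjunct2, THEN conjunct1]
  show "(\<lambda>x. v x - w x) \<in> L2 \<Omega>" "(\<lambda>x. g x - h x) \<in> L2 \<Omega>"
    by (intro L2_diff L2)+
  fix \<phi> j assume \<phi>: "\<phi> \<in> test_functions \<Omega>"
  note test = test_functions_subset_L2[OF \<Omega> \<phi>] test_functions_subset_L2[OF \<Omega> partial_test_function[OF \<phi>]]
  have "(\<integral>x. (v x - w x) * partial j \<phi> x \<partial>lebesgue_on \<Omega>) =
      (\<integral>x. v x * partial j \<phi> x \<partial>lebesgue_on \<Omega>) - (\<integral>x. w x * partial j \<phi> x \<partial>lebesgue_on \<Omega>)"
    unfolding left_diff_distrib
    by (intro Bochner_Integration.integral_diff L2_integrable_mult L2 test)
  also have "\<dots> = - ((\<integral>x. g x $ j * \<phi> x \<partial>lebesgue_on \<Omega>) - (\<integral>x. h x $ j * \<phi> x \<partial>lebesgue_on \<Omega>))"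
    using v w \<phi> by (simp add: is_weak_gradient_def)
  also have "(\<integral>x. g x $ j * \<phi> x \<partial>lebesgue_on \<Omega>) - (\<integral>x. h x $ j * \<phi> x \<partial>lebesgue_on \<Omega>) =
      (\<integral>x. (g x - h x) $ j * \<phi> x \<partial>lebesgue_on \<Omega>)"
    unfolding vector_minus_component left_diff_distrib
    by (intro Bochner_Integration.integral_diff[symmetric] L2_integrable_mult L2_vec_nth L2 test)
  finally show "(\<integral>x. (v x - w x) * partial j \<phi> x \<partial>lebesgue_on \<Omega>) =
      - (\<integral>x. (g x - h x) $ j * \<phi> x \<partial>lebesgue_on \<Omega>)" .
qed

lemma is_weak_gradient_null:
  assumes \<Omega>: "\<Omega> \<in> sets lebesgue" and v: "AE x in lebesgue_on \<Omega>. v x = 0"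
  shows "is_weak_gradient \<Omega> v (\<lambda>x. 0)"
  unfolding is_weak_gradient_def
proof (intro conjI ballI allI)
  show "v \<in> L2 \<Omega>"
    using L2_zero \<Omega> by (rule L2_cong_AE) (use v in \<open>auto elim: eventually_mono\<close>)
  show "(\<lambda>x. 0) \<in> L2 \<Omega>"
    by (rule L2_zero)
  fix \<phi> j
  have "(\<integral>x. v x * partial j \<phi> x \<partial>lebesgue_on \<Omega>) = 0"
    by (rule integral_eq_zero_AE) (use v in \<open>auto elim: eventually_mono\<close>)
  then show "(\<integral>x. v x * partial j \<phi> x \<partial>lebesgue_on \<Omega>) = - (\<integral>x. 0 $ j * \<phi> x \<partial>lebesgue_on \<Omega>)"
    by simp
qed

text \<open>For a null \<open>v\<close> the defining identity says that each component of
  \<open>g\<close> integrates to 0 against every test function, and the fundamental lemma applies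
  componentwise.\<close>

lemma is_weak_gradient_null_unique:
  assumes \<Omega>: "open \<Omega>" and v: "AE x in lebesgue_on \<Omega>. v x = 0" and g: "is_weak_gradient \<Omega> v g"
  shows "AE x in lebesgue_on \<Omega>. g x = 0"
proof -
  have "AE x in lebesgue_on \<Omega>. g x $ j = 0" for j
  proof (rule L2_AE_zero_if_test_integrals_zero[OF \<Omega>])
    show "(\<lambda>x. g x $ j) \<in> L2 \<Omega>"
      using g by (auto simp: is_weak_gradient_def intro: L2_vec_nth)
    fix \<phi> assume "\<phi> \<in> test_functions \<Omega>"
    then have "(\<integral>x. g x $ j * \<phi> x \<partial>lebesgue_on \<Omega>) = - (\<integral>x. v x * partial j \<phi> x \<partial>lebesgue_on \<Omega>)"
      using g by (simp add: is_weak_gradient_def)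
    also have "(\<integral>x. v x * partial j \<phi> x \<partial>lebesgue_on \<Omega>) = 0"
      by (rule integral_eq_zero_AE) (use v in \<open>auto elim: eventually_mono\<close>)
    finally show "(\<integral>x. g x $ j * \<phi> x \<partial>lebesgue_on \<Omega>) = 0"
      by simp
  qed
  then have "AE x in lebesgue_on \<Omega>. \<forall>j. g x $ j = 0"
    by (simp add: AE_all_countable)
  then show ?thesis
    by (simp add: vec_eq_iff)
qed

text \<open>The choices made by \<open>wgrad\<close> for three functions are unrelated. But the
  chosen gradient of the difference and the difference of the chosen gradients are both weak
  gradients of the same function, so they differ by a weak gradient of 0.\<close>

lemma wgrad_diff:
  assumes \<Omega>: "open \<Omega>" and v: "v \<in> H1 \<Omega>" and w: "w \<in> H1 \<Omega>"
  shows "AE x in lebesgue_on \<Omega>. wgrad \<Omega> (\<lambda>x. v x - w x) x = wgrad \<Omega> v x - wgrad \<Omega> w x"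
proof -
  have \<Omega>': "\<Omega> \<in> sets lebesgue"
    using \<Omega> by auto
  let ?d = "\<lambda>x. v x - w x"
  have d: "is_weak_gradient \<Omega> ?d (\<lambda>x. wgrad \<Omega> v x - wgrad \<Omega> w x)"
    by (intro is_weak_gradient_diff \<Omega>' is_weak_gradient_wgrad v w)
  then have "is_weak_gradient \<Omega> ?d (wgrad \<Omega> ?d)"
    by (intro is_weak_gradient_wgrad) (auto simp: H1_def)
  from is_weak_gradient_diff[OF \<Omega>' this d]
  have "AE x in lebesgue_on \<Omega>. wgrad \<Omega> ?d x - (wgrad \<Omega> v x - wgrad \<Omega> w x) = 0"
    by (intro is_weak_gradient_null_unique[OF \<Omega>, where v = "\<lambda>x. ?d x - ?d x"]) auto
  then show ?thesis by eventually_elim simp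
qed

lemma wgrad_null:
  assumes \<Omega>: "open \<Omega>" and v: "AE x in lebesgue_on \<Omega>. v x = 0"
  shows "v \<in> H1 \<Omega>" "AE x in lebesgue_on \<Omega>. wgrad \<Omega> v x = 0"
proof -
  have "\<Omega> \<in> sets lebesgue"
    using \<Omega> by auto
  then show "v \<in> H1 \<Omega>"
    using is_weak_gradient_null[OF _ v] by (auto simp: H1_def)
  then show "AE x in lebesgue_on \<Omega>. wgrad \<Omega> v x = 0"
    by (intro is_weak_gradient_null_unique[OF \<Omega> v] is_weak_gradient_wgrad)
qed

lemma vec_space_H1_subset_L2:
  assumes "\<tau> \<in> vec_space (H1 \<Omega>)"
  shows "\<tau> \<in> L2 \<Omega>"
proof -
  have "(\<lambda>x. \<tau> x $ i) \<in> L2 \<Omega>" for i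
    using is_weak_gradient_wgrad[of "\<lambda>x. \<tau> x $ i" \<Omega>] assms
    by (simp add: vec_space_def is_weak_gradient_def)
  then have meas: "(\<lambda>x. \<tau> x $ i) \<in> borel_measurable (lebesgue_on \<Omega>)"
    and int: "integrable (lebesgue_on \<Omega>) (\<lambda>x. (\<tau> x $ i)\<^sup>2)" for i
    by (auto simp: L2_def)
  have "\<tau> \<in> borel_measurable (lebesgue_on \<Omega>)"
    using meas by (subst borel_measurable_euclidean_space) (auto simp: Basis_vec_def inner_axis)
  moreover have "integrable (lebesgue_on \<Omega>) (\<lambda>x. \<Sum>i\<in>UNIV. (\<tau> x $ i)\<^sup>2)"
    by (intro Bochner_Integration.integrable_sum int)
  ultimately show ?thesis
    by (simp add: L2_def norm_vec_def L2_set_def sum_nonneg)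
qed

subsection \<open>Least-squares functionals\<close>

text \<open>
  Both functionals are instances: the mesh with weights \<open>h_K\<^sup>2\<close>, and \<open>{\<Omega>}\<close> with weight 1.
  The squared triple norms are the same functionals with data \<open>f = 0\<close>.
\<close>

definition ls_functional ::
  "(real^'n::finite) set \<Rightarrow> (real^'n) set set \<Rightarrow> ((real^'n) set \<Rightarrow> real) \<Rightarrow>
   ((real^'n \<Rightarrow> real^'n) \<Rightarrow> real^'n \<Rightarrow> real) \<Rightarrow>
   (real^'n \<Rightarrow> real) \<Rightarrow> (real^'n \<Rightarrow> real) \<times> (real^'n \<Rightarrow> real^'n) \<Rightarrow> real" where
  "ls_functional \<Omega> \<P> w Agrad f = (\<lambda>(v, \<tau>).
     (\<Sum>K\<in>\<P>. w K * (L2norm K (\<lambda>x. f x + Agrad \<tau> x))\<^sup>2)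
     + (L2norm \<Omega> (\<lambda>x. \<tau> x - wgrad \<Omega> v x))\<^sup>2)"

lemma J\<^sub>h_eq_ls_functional: "J\<^sub>h \<Omega> \<T> Agrad f = ls_functional \<Omega> \<T> (\<lambda>K. (diameter K)\<^sup>2) Agrad f"
  by (simp add: J\<^sub>h_def ls_functional_def)

lemma J\<^sub>0_eq_ls_functional: "J\<^sub>0 \<Omega> Agrad f = ls_functional \<Omega> {\<Omega>} (\<lambda>_. 1) Agrad f"
  by (simp add: J\<^sub>0_def ls_functional_def)

lemma triple_norm\<^sub>h_eq_ls_functional:
  "triple_norm\<^sub>h \<Omega> \<T> Agrad p = sqrt (ls_functional \<Omega> \<T> (\<lambda>K. (diameter K)\<^sup>2) Agrad (\<lambda>_. 0) p)"
  by (cases p) (simp add: triple_norm\<^sub>h_def ls_functional_def)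

lemma triple_norm\<^sub>0_eq_ls_functional:
  "triple_norm\<^sub>0 \<Omega> Agrad p = sqrt (ls_functional \<Omega> {\<Omega>} (\<lambda>_. 1) Agrad (\<lambda>_. 0) p)"
  by (cases p) (simp add: triple_norm\<^sub>0_def ls_functional_def)

section \<open>The operator A : grad and its independence of representatives\<close>

locale nondivergence_operator =
  fixes \<Omega> :: "(real^'n::finite) set"
    and A :: "real^'n \<Rightarrow> real^'n^'n"
    and Agrad :: "(real^'n \<Rightarrow> real^'n) \<Rightarrow> real^'n \<Rightarrow> real"
  assumes \<Omega>: "open \<Omega>"
    and A: "A \<in> Linfty \<Omega>"
    and Agrad: "A_grad_operator \<Omega> A Agrad"
begin

lemma \<Omega>_sets [simp]: "\<Omega> \<in> sets lebesgue"
  using \<Omega> by auto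

lemma Agrad_add:
  "\<tau> \<in> Qspace \<Omega> Agrad \<Longrightarrow> \<rho> \<in> Qspace \<Omega> Agrad \<Longrightarrow>
   AE x in lebesgue_on \<Omega>. Agrad (\<lambda>y. \<tau> y + \<rho> y) x = Agrad \<tau> x + Agrad \<rho> x"
  and Agrad_scaleR:
  "\<tau> \<in> Qspace \<Omega> Agrad \<Longrightarrow> AE x in lebesgue_on \<Omega>. Agrad (\<lambda>y. c *\<^sub>R \<tau> y) x = c * Agrad \<tau> x"
  and Agrad_H1:
  "\<tau> \<in> vec_space (H1 \<Omega>) \<Longrightarrow> AE x in lebesgue_on \<Omega>. Agrad \<tau> x = frob (A x) (wjacobian \<Omega> \<tau> x)"
  using Agrad by (auto simp: A_grad_operator_def)

text \<open>\<open>A_grad_operator\<close> does not state that \<open>Qspace\<close> is closed under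
  linear operations; closure follows because the new value of \<open>Agrad\<close> agrees a.e. with
  a square-integrable function. Negation comes before the sum, as additivity is available only for
  arguments already in \<open>Qspace\<close>.\<close>

lemma Qspace_diff:
  assumes \<tau>: "\<tau> \<in> Qspace \<Omega> Agrad" and \<rho>: "\<rho> \<in> Qspace \<Omega> Agrad"
  shows "(\<lambda>x. \<tau> x - \<rho> x) \<in> Qspace \<Omega> Agrad"
    and "AE x in lebesgue_on \<Omega>. Agrad (\<lambda>y. \<tau> y - \<rho> y) x = Agrad \<tau> x - Agrad \<rho> x"
proof -
  note L2 = \<tau>[unfolded Qspace_def, simplified] \<rho>[unfolded Qspace_def, simplified]
  have neg: "AE x in lebesgue_on \<Omega>. - Agrad \<rho> x = Agrad (\<lambda>y. (- 1) *\<^sub>R \<rho> y) x"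
    using Agrad_scaleR[OF \<rho>, of "- 1"] by eventually_elim simp
  have "Agrad (\<lambda>y. (- 1) *\<^sub>R \<rho> y) \<in> L2 \<Omega>"
    by (rule L2_cong_AE[OF L2_minus \<Omega>_sets neg]) (use L2 in simp)
  then have "(\<lambda>y. (- 1) *\<^sub>R \<rho> y) \<in> Qspace \<Omega> Agrad"
    unfolding Qspace_def using L2_scaleR[of \<rho> \<Omega> "- 1"] L2 by blast
  from Agrad_add[OF \<tau> this] neg
  show *: "AE x in lebesgue_on \<Omega>. Agrad (\<lambda>y. \<tau> y - \<rho> y) x = Agrad \<tau> x - Agrad \<rho> x"
    by eventually_elim simp
  have "AE x in lebesgue_on \<Omega>. Agrad \<tau> x - Agrad \<rho> x = Agrad (\<lambda>y. \<tau> y - \<rho> y) x"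
    using * by eventually_elim simp
  from L2_cong_AE[OF L2_diff \<Omega>_sets this] L2 have "Agrad (\<lambda>y. \<tau> y - \<rho> y) \<in> L2 \<Omega>"
    by simp
  then show "(\<lambda>x. \<tau> x - \<rho> x) \<in> Qspace \<Omega> Agrad"
    using L2 by (auto simp: Qspace_def intro: L2_diff)
qed

text \<open>Bounded coefficients times square-integrable derivatives: here the boundedness of
  \<open>A\<close> enters. As a consequence the discrete vector fields are admissible in
  \<open>Qspace\<close>.\<close>

lemma vec_space_H1_subset_Qspace:
  assumes \<tau>: "\<tau> \<in> vec_space (H1 \<Omega>)"
  shows "\<tau> \<in> Qspace \<Omega> Agrad"
proof -
  have "(\<lambda>x. wgrad \<Omega> (\<lambda>y. \<tau> y $ i) x $ j) \<in> L2 \<Omega>" for i j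
    using \<tau> by (intro L2_vec_nth wgrad_L2) (simp add: vec_space_def)
  then have "(\<lambda>x. frob (A x) (wjacobian \<Omega> \<tau> x)) \<in> L2 \<Omega>"
    unfolding frob_def wjacobian_def vec_lambda_beta
    by (intro L2_sum Linfty_mult_L2 Linfty_vec_nth A)
  moreover have "AE x in lebesgue_on \<Omega>. frob (A x) (wjacobian \<Omega> \<tau> x) = Agrad \<tau> x"
    using Agrad_H1[OF \<tau>] by eventually_elim simp
  ultimately have "Agrad \<tau> \<in> L2 \<Omega>"
    by (rule L2_cong_AE[OF _ \<Omega>_sets])
  with vec_space_H1_subset_L2[OF \<tau>] show ?thesis
    by (simp add: Qspace_def)
qed

text \<open>
  A null field lies in \<open>H\<^sup>1\<close> with weak gradient 0, so the a.e. expression for \<open>A : \<nabla>\<close> applies to it; by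
  linearity the operator does not depend on representatives.
\<close>

lemma Agrad_null:
  assumes "AE x in lebesgue_on \<Omega>. \<tau> x = 0"
  shows "\<tau> \<in> Qspace \<Omega> Agrad" "AE x in lebesgue_on \<Omega>. Agrad \<tau> x = 0"
proof -
  have comp: "AE x in lebesgue_on \<Omega>. \<tau> x $ i = 0" for i
    using assms by eventually_elim simp
  have H1: "\<tau> \<in> vec_space (H1 \<Omega>)"
    using wgrad_null(1)[OF \<Omega> comp] by (simp add: vec_space_def)
  then show "\<tau> \<in> Qspace \<Omega> Agrad"
    by (rule vec_space_H1_subset_Qspace)
  have "AE x in lebesgue_on \<Omega>. \<forall>i. wgrad \<Omega> (\<lambda>y. \<tau> y $ i) x = 0"
    using wgrad_null(2)[OF \<Omega> comp] by (simp add: AE_all_countable)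
  with Agrad_H1[OF H1] show "AE x in lebesgue_on \<Omega>. Agrad \<tau> x = 0"
    by eventually_elim (simp add: frob_def wjacobian_def)
qed

text \<open>\<rho> is \<tau> minus the null field \<tau> - \<rho>, so linearity reduces the claim to
  \<open>Agrad_null\<close>.\<close>

lemma Agrad_cong_AE:
  assumes \<tau>: "\<tau> \<in> Qspace \<Omega> Agrad" and ae: "AE x in lebesgue_on \<Omega>. \<tau> x = \<rho> x"
  shows "\<rho> \<in> Qspace \<Omega> Agrad" "AE x in lebesgue_on \<Omega>. Agrad \<rho> x = Agrad \<tau> x"
proof -
  let ?d = "\<lambda>x. \<tau> x - \<rho> x"
  have "AE x in lebesgue_on \<Omega>. ?d x = 0"
    using ae by eventually_elim simp
  note d = Agrad_null[OF this]
  show "\<rho> \<in> Qspace \<Omega> Agrad"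
    using Qspace_diff(1)[OF \<tau> d(1)] by simp
  have "AE x in lebesgue_on \<Omega>. Agrad \<rho> x = Agrad \<tau> x - Agrad ?d x"
    using Qspace_diff(2)[OF \<tau> d(1)] by simp
  with d(2) show "AE x in lebesgue_on \<Omega>. Agrad \<rho> x = Agrad \<tau> x"
    by eventually_elim simp
qed

end

text \<open>The pieces may stick out of \<open>\<Omega>\<close> by a null set, as closed simplices do.\<close>

locale weighted_partition = nondivergence_operator +
  fixes \<P> :: "(real^'n) set set" and w :: "(real^'n) set \<Rightarrow> real"
  assumes finite_\<P>: "finite \<P>"
    and sets_\<P>: "K \<in> \<P> \<Longrightarrow> K \<in> sets lebesgue"
    and null_\<P>: "K \<in> \<P> \<Longrightarrow> negligible (K - \<Omega>)"
    and cover_\<P>: "\<Omega> \<subseteq> \<Union>\<P>"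
    and w_pos: "K \<in> \<P> \<Longrightarrow> 0 < w K"
begin

lemma AE_piece:
  assumes K: "K \<in> \<P>" and ae: "AE x in lebesgue_on \<Omega>. P x"
  shows "AE x in lebesgue_on K. P x"
proof -
  have "AE x in lebesgue. x \<notin> K - \<Omega>"
    using null_\<P>[OF K] unfolding negligible_iff_null_sets by (rule AE_not_in)
  with ae show ?thesis
    unfolding AE_lebesgue_on_iff[OF \<Omega>_sets] AE_lebesgue_on_iff[OF sets_\<P>[OF K]]
    by eventually_elim auto
qed

lemma ls_functional_nonneg: "0 \<le> ls_functional \<Omega> \<P> w Agrad f p"
  by (cases p) (auto simp: ls_functional_def less_imp_le[OF w_pos] intro!: add_nonneg_nonneg sum_nonneg)

text \<open>Positive weights force every term to vanish separately, and finitely many pieces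
  covering \<Omega> glue the local equations together. The zero set is thus the same for all
  partitions and weights, in particular for \<open>J\<^sub>0\<close> and
  \<open>J\<^sub>h\<close>.\<close>

lemma ls_functional_eq_0_iff:
  assumes f: "f \<in> L2 \<Omega>" and v: "v \<in> H1 \<Omega>" and \<tau>: "\<tau> \<in> Qspace \<Omega> Agrad"
  shows "ls_functional \<Omega> \<P> w Agrad f (v, \<tau>) = 0 \<longleftrightarrow>
    (AE x in lebesgue_on \<Omega>. f x + Agrad \<tau> x = 0) \<and> (AE x in lebesgue_on \<Omega>. \<tau> x = wgrad \<Omega> v x)"
proof -
  let ?r = "\<lambda>x. f x + Agrad \<tau> x"
  have r: "?r \<in> L2 \<Omega>"
    using f \<tau> by (auto simp: Qspace_def intro: L2_add)
  have g: "(\<lambda>x. \<tau> x - wgrad \<Omega> v x) \<in> L2 \<Omega>"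
    using \<tau> v by (auto simp: Qspace_def intro: L2_diff wgrad_L2)
  have "ls_functional \<Omega> \<P> w Agrad f (v, \<tau>) = 0 \<longleftrightarrow>
      (\<forall>K\<in>\<P>. L2norm K ?r = 0) \<and> L2norm \<Omega> (\<lambda>x. \<tau> x - wgrad \<Omega> v x) = 0"
  proof -
    have nonneg: "0 \<le> w K * (L2norm K ?r)\<^sup>2" if "K \<in> \<P>" for K
      using w_pos[OF that] by simp
    then have "0 \<le> (\<Sum>K\<in>\<P>. w K * (L2norm K ?r)\<^sup>2)"
      by (rule sum_nonneg)
    then have "ls_functional \<Omega> \<P> w Agrad f (v, \<tau>) = 0 \<longleftrightarrow>
        (\<Sum>K\<in>\<P>. w K * (L2norm K ?r)\<^sup>2) = 0 \<and> (L2norm \<Omega> (\<lambda>x. \<tau> x - wgrad \<Omega> v x))\<^sup>2 = 0"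
      by (simp only: ls_functional_def prod.case add_nonneg_eq_0_iff zero_le_power2)
    also have "(\<Sum>K\<in>\<P>. w K * (L2norm K ?r)\<^sup>2) = 0 \<longleftrightarrow> (\<forall>K\<in>\<P>. w K * (L2norm K ?r)\<^sup>2 = 0)"
      using finite_\<P> nonneg by (rule sum_nonneg_eq_0_iff)
    finally show ?thesis
      using w_pos by fastforce
  qed
  also have "(\<forall>K\<in>\<P>. L2norm K ?r = 0) \<longleftrightarrow> (\<forall>K\<in>\<P>. AE x in lebesgue_on K. ?r x = 0)"
    using L2norm_eq_0_iff[OF L2_subset_AE[OF r \<Omega>_sets sets_\<P> null_\<P>]] by blast
  also have "\<dots> \<longleftrightarrow> (AE x in lebesgue_on \<Omega>. ?r x = 0)"
  proof
    assume "\<forall>K\<in>\<P>. AE x in lebesgue_on K. ?r x = 0"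
    then have "AE x in lebesgue. \<forall>K\<in>\<P>. x \<in> K \<longrightarrow> ?r x = 0"
      by (intro AE_finite_all[OF finite_\<P>, THEN iffD2]) (simp flip: AE_lebesgue_on_iff[OF sets_\<P>])
    then show "AE x in lebesgue_on \<Omega>. ?r x = 0"
      unfolding AE_lebesgue_on_iff[OF \<Omega>_sets]
      by eventually_elim (use cover_\<P> in blast)
  qed (blast intro: AE_piece)
  also have "L2norm \<Omega> (\<lambda>x. \<tau> x - wgrad \<Omega> v x) = 0 \<longleftrightarrow> (AE x in lebesgue_on \<Omega>. \<tau> x = wgrad \<Omega> v x)"
    using L2norm_eq_0_iff[OF g] by simp
  finally show ?thesis .
qed

lemma minimizer_solves:
  assumes wellposed: "uniquely_solvable \<Omega> Agrad" and f: "f \<in> L2 \<Omega>"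
    and min: "minimizes_over (ls_functional \<Omega> \<P> w Agrad f) (H10 \<Omega> \<times> Qspace \<Omega> Agrad) (u, \<sigma>)"
  shows "solves_nondiv \<Omega> Agrad f u" "AE x in lebesgue_on \<Omega>. \<sigma> x = wgrad \<Omega> u x"
    "\<sigma> \<in> Qspace \<Omega> Agrad"
proof -
  have H10: "H10 \<Omega> \<subseteq> H1 \<Omega>"
    by (auto simp: H10_def)
  have u: "u \<in> H10 \<Omega>" and \<sigma>: "\<sigma> \<in> Qspace \<Omega> Agrad"
    using min by (simp_all add: minimizes_over_def is_arg_min_def)
  obtain v where "solves_nondiv \<Omega> Agrad f v"
    using wellposed f unfolding uniquely_solvable_def by blast
  then have v: "v \<in> H10 \<Omega>" "A_hess \<Omega> Agrad v \<in> L2 \<Omega>"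
    and ae: "AE x in lebesgue_on \<Omega>. - A_hess \<Omega> Agrad v x = f x"
    by (simp_all add: solves_nondiv_def Vspace_def)
  have v': "wgrad \<Omega> v \<in> Qspace \<Omega> Agrad"
    using v H10 by (auto simp: Qspace_def A_hess_def intro: wgrad_L2)
  have "AE x in lebesgue_on \<Omega>. f x + Agrad (wgrad \<Omega> v) x = 0"
    using ae by eventually_elim (simp add: A_hess_def)
  then have "ls_functional \<Omega> \<P> w Agrad f (v, wgrad \<Omega> v) = 0"
    using v(1) v' H10 f by (subst ls_functional_eq_0_iff) auto
  moreover have "\<not> ls_functional \<Omega> \<P> w Agrad f (v, wgrad \<Omega> v) < ls_functional \<Omega> \<P> w Agrad f (u, \<sigma>)"
    using min v(1) v' unfolding minimizes_over_def is_arg_min_def by blast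
  ultimately have "ls_functional \<Omega> \<P> w Agrad f (u, \<sigma>) = 0"
    using ls_functional_nonneg[of f "(u, \<sigma>)"] by simp
  then have eq: "AE x in lebesgue_on \<Omega>. f x + Agrad \<sigma> x = 0"
    and grad: "AE x in lebesgue_on \<Omega>. \<sigma> x = wgrad \<Omega> u x"
    using u H10 \<sigma> f by (auto simp: ls_functional_eq_0_iff)
  \<comment> \<open>The residual equation concerns \<open>Agrad \<sigma>\<close>, whereas
    \<open>A_hess\<close> evaluates \<open>Agrad\<close> at \<open>wgrad \<Omega> u\<close>. The
    same exchange puts \<open>u\<close> into \<open>Vspace\<close>.\<close>
  note cong = Agrad_cong_AE[OF \<sigma> grad]
  have "AE x in lebesgue_on \<Omega>. - A_hess \<Omega> Agrad u x = f x"
    using eq cong(2) by eventually_elim (simp add: A_hess_def)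
  with u cong(1) show "solves_nondiv \<Omega> Agrad f u"
    by (simp add: solves_nondiv_def Vspace_def A_hess_def Qspace_def)
  show "AE x in lebesgue_on \<Omega>. \<sigma> x = wgrad \<Omega> u x" "\<sigma> \<in> Qspace \<Omega> Agrad"
    by fact+
qed

text \<open>Almost everywhere f + A : grad \<tau> = -A : grad (\<sigma> - \<tau>) and \<tau> - grad
  v = -((\<sigma> - \<tau>) - grad (u - v)). Both terms of the functional are therefore negatives of
  the error terms, a sign that the norms do not see.\<close>

lemma ls_functional_eq_error:
  assumes f: "f \<in> L2 \<Omega>" and u: "u \<in> H1 \<Omega>" and \<sigma>: "\<sigma> \<in> Qspace \<Omega> Agrad"
    and eq: "AE x in lebesgue_on \<Omega>. f x + Agrad \<sigma> x = 0"
    and grad: "AE x in lebesgue_on \<Omega>. \<sigma> x = wgrad \<Omega> u x"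
    and v: "v \<in> H1 \<Omega>" and \<tau>: "\<tau> \<in> Qspace \<Omega> Agrad"
  shows "ls_functional \<Omega> \<P> w Agrad f (v, \<tau>) =
    ls_functional \<Omega> \<P> w Agrad (\<lambda>_. 0) (\<lambda>x. u x - v x, \<lambda>x. \<sigma> x - \<tau> x)"
proof -
  let ?e = "\<lambda>x. \<sigma> x - \<tau> x"
  have r: "(\<lambda>x. f x + Agrad \<tau> x) \<in> L2 \<Omega>"
    using f \<tau> by (auto simp: Qspace_def intro: L2_add)
  have e: "?e \<in> Qspace \<Omega> Agrad"
    using \<sigma> \<tau> by (rule Qspace_diff(1))
  have residual: "AE x in lebesgue_on \<Omega>. norm (f x + Agrad \<tau> x) = norm (0 + Agrad ?e x)"
    using eq Qspace_diff(2)[OF \<sigma> \<tau>]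
    by eventually_elim (simp add: abs_if)
  \<comment> \<open>The summand 0 on the right is the data function of the squared triple
    norm.\<close>
  have "L2norm K (\<lambda>x. f x + Agrad \<tau> x) = L2norm K (\<lambda>x. 0 + Agrad ?e x)" if K: "K \<in> \<P>" for K
  proof (rule L2norm_cong_AE[OF _ sets_\<P>[OF K]])
    show "(\<lambda>x. f x + Agrad \<tau> x) \<in> L2 K"
      using r \<Omega>_sets sets_\<P>[OF K] null_\<P>[OF K] by (rule L2_subset_AE)
    show "AE x in lebesgue_on K. norm (f x + Agrad \<tau> x) = norm (0 + Agrad ?e x)"
      using K residual by (rule AE_piece)
    have "(\<lambda>x. 0 + Agrad ?e x) \<in> L2 \<Omega>"
      using e by (simp add: Qspace_def)
    then have "(\<lambda>x. 0 + Agrad ?e x) \<in> L2 K"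
      using \<Omega>_sets sets_\<P>[OF K] null_\<P>[OF K] by (rule L2_subset_AE)
    then show "(\<lambda>x. 0 + Agrad ?e x) \<in> borel_measurable (lebesgue_on K)"
      by (rule L2_measurable)
  qed
  moreover have "L2norm \<Omega> (\<lambda>x. \<tau> x - wgrad \<Omega> v x) = L2norm \<Omega> (\<lambda>x. ?e x - wgrad \<Omega> (\<lambda>x. u x - v x) x)"
  proof (rule L2norm_cong_AE)
    show "(\<lambda>x. \<tau> x - wgrad \<Omega> v x) \<in> L2 \<Omega>"
      using \<tau> v by (auto simp: Qspace_def intro: L2_diff wgrad_L2)
    have "(\<lambda>x. u x - v x) \<in> H1 \<Omega>"
      using is_weak_gradient_diff[OF \<Omega>_sets u[THEN is_weak_gradient_wgrad] v[THEN is_weak_gradient_wgrad]]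
      by (auto simp: H1_def)
    then show "(\<lambda>x. ?e x - wgrad \<Omega> (\<lambda>x. u x - v x) x) \<in> borel_measurable (lebesgue_on \<Omega>)"
      using \<sigma> \<tau> by (intro L2_measurable L2_diff wgrad_L2) (auto simp: Qspace_def)
    show "AE x in lebesgue_on \<Omega>. norm (\<tau> x - wgrad \<Omega> v x) =
        norm (?e x - wgrad \<Omega> (\<lambda>x. u x - v x) x)"
      using grad wgrad_diff[OF \<Omega> u v]
      by eventually_elim (simp add: norm_minus_commute)
  qed simp
  ultimately show ?thesis
    by (simp add: ls_functional_def)
qed

text \<open>The left side is a lower bound for every member of the family, by monotonicity of the
  square root. A lower bound passes to a real infimum only over a nonempty index set; the discrete
  minimizer itself is a member.\<close>

lemma minimizer_best_approximation:
  assumes f: "f \<in> L2 \<Omega>" and u: "solves_nondiv \<Omega> Agrad f u" and \<sigma>: "\<sigma> \<in> Qspace \<Omega> Agrad"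
    and grad: "AE x in lebesgue_on \<Omega>. \<sigma> x = wgrad \<Omega> u x"
    and X: "X \<subseteq> H1 \<Omega>" and Y: "Y \<subseteq> vec_space (H1 \<Omega>)"
    and min: "minimizes_over (ls_functional \<Omega> \<P> w Agrad f) (X \<times> Y) (u\<^sub>h, \<sigma>\<^sub>h)"
  shows "sqrt (ls_functional \<Omega> \<P> w Agrad (\<lambda>_. 0) (\<lambda>x. u x - u\<^sub>h x, \<lambda>x. \<sigma> x - \<sigma>\<^sub>h x))
    \<le> (INF (v\<^sub>h, \<tau>\<^sub>h) \<in> X \<times> Y.
         sqrt (ls_functional \<Omega> \<P> w Agrad (\<lambda>_. 0) (\<lambda>x. u x - v\<^sub>h x, \<lambda>x. \<sigma> x - \<tau>\<^sub>h x)))"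
proof (rule cINF_greatest)
  have uh: "(u\<^sub>h, \<sigma>\<^sub>h) \<in> X \<times> Y"
    and le: "p \<in> X \<times> Y \<Longrightarrow> ls_functional \<Omega> \<P> w Agrad f (u\<^sub>h, \<sigma>\<^sub>h) \<le> ls_functional \<Omega> \<P> w Agrad f p" for p
    using min by (auto simp: minimizes_over_def is_arg_min_def not_less)
  then show "X \<times> Y \<noteq> {}" by blast
  have "AE x in lebesgue_on \<Omega>. f x + Agrad \<sigma> x = 0"
    using Agrad_cong_AE(2)[OF \<sigma> grad] u[unfolded solves_nondiv_def, THEN conjunct2]
    by eventually_elim (simp add: A_hess_def)
  moreover have "u \<in> H1 \<Omega>"
    using u by (simp add: solves_nondiv_def Vspace_def H10_def)
  ultimately have error: "ls_functional \<Omega> \<P> w Agrad (\<lambda>_. 0) (\<lambda>x. u x - v x, \<lambda>x. \<sigma> x - \<tau> x) =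
      ls_functional \<Omega> \<P> w Agrad f (v, \<tau>)" if "(v, \<tau>) \<in> X \<times> Y" for v \<tau>
    using that X Y vec_space_H1_subset_Qspace
    by (intro ls_functional_eq_error[symmetric] f \<sigma> grad) auto
  fix p assume p: "p \<in> X \<times> Y"
  then obtain v \<tau> where [simp]: "p = (v, \<tau>)" by (cases p)
  show "sqrt (ls_functional \<Omega> \<P> w Agrad (\<lambda>_. 0) (\<lambda>x. u x - u\<^sub>h x, \<lambda>x. \<sigma> x - \<sigma>\<^sub>h x))
      \<le> (case p of (v\<^sub>h, \<tau>\<^sub>h) \<Rightarrow>
           sqrt (ls_functional \<Omega> \<P> w Agrad (\<lambda>_. 0) (\<lambda>x. u x - v\<^sub>h x, \<lambda>x. \<sigma> x - \<tau>\<^sub>h x)))"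
    using p le[OF p] error[OF uh] error[of v \<tau>] by simp
qed

end

subsection \<open>Simplicial meshes\<close>

lemma open_polytope_imp_open: "open_polytope \<Omega> \<Longrightarrow> open \<Omega>"
  by (auto simp: open_polytope_def)

text \<open>\<Omega> is the interior of a closed set, so passing to the closure cannot fill in a
  slit. This places the interiors of mesh simplices, known only to lie in the closure, inside
  \<Omega>.\<close>

lemma open_polytope_interior_closure:
  assumes "open_polytope \<Omega>"
  shows "interior (closure \<Omega>) \<subseteq> \<Omega>"
proof -
  obtain \<P> where \<P>: "finite \<P>" "\<And>P. P \<in> \<P> \<Longrightarrow> polytope P" "\<Omega> = interior (\<Union>\<P>)"
    using assms by (auto simp: open_polytope_def)
  have "closed (\<Union>\<P>)"
    using \<P> by (intro closed_Union) (auto intro: polytope_imp_closed)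
  then have "closure \<Omega> \<subseteq> \<Union>\<P>"
    using \<P>(3) by (simp add: closure_minimal interior_subset)
  then show ?thesis
    using \<P>(3) by (simp add: interior_mono)
qed

text \<open>A simplex of positive dimension has two distinct vertices. The mesh weights are positive
  for this reason.\<close>

lemma simplex_diameter_pos:
  assumes "int n simplex K" "0 < n"
  shows "0 < diameter K"
proof -
  obtain C where C: "finite C" "card C = n + 1" "K = convex hull C"
    using assms(1) by (auto simp: simplex)
  then have "\<not> card C \<le> 1"
    using assms(2) by simp
  then obtain x y where xy: "x \<in> C" "y \<in> C" "x \<noteq> y"
    using C(1) by (auto simp: card_le_Suc0_iff_eq)
  have "bounded K"
    using C by (simp add: bounded_convex_hull finite_imp_bounded)
  then have "dist x y \<le> diameter K"
    using xy C(3) by (intro diameter_bounded_bound) (auto intro: hull_inc)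
  with xy show ?thesis
    using zero_less_dist_iff[of x y] by linarith
qed

text \<open>The interior of \<open>K\<close> lies in \<Omega>, so what sticks out lies in the
  frontier of a convex set, which is null.\<close>

lemma simplicial_mesh_piece:
  assumes \<Omega>: "open_polytope \<Omega>" and mesh: "simplicial_mesh \<Omega> \<T>" and K: "K \<in> \<T>"
  shows "K \<in> sets lebesgue" "negligible (K - \<Omega>)" "0 < diameter K"
proof -
  have K_simplex: "int CARD('a) simplex K"
    using mesh K by (auto simp: simplicial_mesh_def)
  show "0 < diameter K"
    using K_simplex by (rule simplex_diameter_pos) simp
  obtain C where C: "finite C" "K = convex hull C"
    using K_simplex by (auto simp: simplex)
  have "compact K"
    using C by (simp add: finite_imp_compact_convex_hull)
  then show "K \<in> sets lebesgue"
    by (simp add: borel_compact)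
  have "K \<subseteq> closure \<Omega>"
    using mesh K by (auto simp: simplicial_mesh_def)
  then have "interior K \<subseteq> \<Omega>"
    using open_polytope_interior_closure[OF \<Omega>] interior_mono by blast
  then have "K - \<Omega> \<subseteq> frontier K"
    using closure_subset by (auto simp: frontier_def)
  moreover have "negligible (frontier K)"
    using C by (simp add: negligible_convex_frontier)
  ultimately show "negligible (K - \<Omega>)"
    using negligible_subset by blast
qed

lemma Sk0_subset_H1: "Sk0 \<Omega> \<T> k \<subseteq> H1 \<Omega>"
  by (auto simp: Sk0_def Sk_def)

lemma vec_space_Sk_subset: "vec_space (Sk \<Omega> \<T> k) \<subseteq> vec_space (H1 \<Omega>)"
  by (auto simp: vec_space_def Sk_def)

section \<open>The best-approximation estimates for the weighted and the unweighted method\<close>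

theorem theorem3p2:
  fixes \<Omega> :: "(real^'n::finite) set"
    and A :: "real^'n \<Rightarrow> real^'n^'n"
    and Agrad :: "(real^'n \<Rightarrow> real^'n) \<Rightarrow> real^'n \<Rightarrow> real"
    and \<T> :: "(real^'n) set set"
    and \<kappa> :: real
    and f u :: "real^'n \<Rightarrow> real"
    and \<sigma> :: "real^'n \<Rightarrow> real^'n"
  assumes dim: "CARD('n) = 2 \<or> CARD('n) = 3"
    and domain: "open_polytope \<Omega>"
    and coeff: "A \<in> Linfty \<Omega>"
    and operator: "A_grad_operator \<Omega> A Agrad"
    and mesh: "simplicial_mesh \<Omega> \<T>"
    and regular: "shape_regular \<kappa> \<T>"
    and wellposed: "uniquely_solvable \<Omega> Agrad"
    and f: "f \<in> L2 \<Omega>"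
    and u\<sigma>: "minimizes_over (J\<^sub>0 \<Omega> Agrad f) (H10 \<Omega> \<times> Qspace \<Omega> Agrad) (u, \<sigma>) \<or>
             minimizes_over (J\<^sub>h \<Omega> \<T> Agrad f) (H10 \<Omega> \<times> Qspace \<Omega> Agrad) (u, \<sigma>)"
  shows "solves_nondiv \<Omega> Agrad f u \<and> (AE x in lebesgue_on \<Omega>. \<sigma> x = wgrad \<Omega> u x) \<and>
    (\<forall>k\<ge>2. \<forall>u\<^sub>h \<sigma>\<^sub>h.
       minimizes_over (J\<^sub>h \<Omega> \<T> Agrad f) (Sk0 \<Omega> \<T> k \<times> vec_space (Sk \<Omega> \<T> (k - 1))) (u\<^sub>h, \<sigma>\<^sub>h) \<longrightarrow>
       triple_norm\<^sub>h \<Omega> \<T> Agrad (\<lambda>x. u x - u\<^sub>h x, \<lambda>x. \<sigma> x - \<sigma>\<^sub>h x)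
         \<le> (INF (v\<^sub>h, \<tau>\<^sub>h) \<in> Sk0 \<Omega> \<T> k \<times> vec_space (Sk \<Omega> \<T> (k - 1)).
              triple_norm\<^sub>h \<Omega> \<T> Agrad (\<lambda>x. u x - v\<^sub>h x, \<lambda>x. \<sigma> x - \<tau>\<^sub>h x))) \<and>
    (\<forall>u\<^sub>h \<sigma>\<^sub>h.
       minimizes_over (J\<^sub>0 \<Omega> Agrad f) (Sk0 \<Omega> \<T> 1 \<times> vec_space (Sk \<Omega> \<T> 1)) (u\<^sub>h, \<sigma>\<^sub>h) \<longrightarrow>
       triple_norm\<^sub>0 \<Omega> Agrad (\<lambda>x. u x - u\<^sub>h x, \<lambda>x. \<sigma> x - \<sigma>\<^sub>h x)
         \<le> (INF (v\<^sub>h, \<tau>\<^sub>h) \<in> Sk0 \<Omega> \<T> 1 \<times> vec_space (Sk \<Omega> \<T> 1).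
              triple_norm\<^sub>0 \<Omega> Agrad (\<lambda>x. u x - v\<^sub>h x, \<lambda>x. \<sigma> x - \<tau>\<^sub>h x)))"
proof -
  interpret nondivergence_operator \<Omega> A Agrad
    using domain coeff operator by unfold_locales (simp_all add: open_polytope_imp_open)
  interpret h: weighted_partition \<Omega> A Agrad \<T> "\<lambda>K. (diameter K)\<^sup>2"
  proof unfold_locales
    show "finite \<T>" "\<Omega> \<subseteq> \<Union>\<T>"
      using mesh closure_subset by (auto simp: simplicial_mesh_def triangulation_def)
    show "K \<in> sets lebesgue" "negligible (K - \<Omega>)" "0 < (diameter K)\<^sup>2" if "K \<in> \<T>" for K
      using simplicial_mesh_piece[OF domain mesh that] by simp_all
  qed
  interpret zero: weighted_partition \<Omega> A Agrad "{\<Omega>}" "\<lambda>_. 1"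
    by unfold_locales simp_all
  \<comment> \<open>Exactness comes from the interpretation matching the functional that the pair
    minimizes. From then on both estimates apply to the pair, whichever functional that was.\<close>
  have exact: "solves_nondiv \<Omega> Agrad f u" "AE x in lebesgue_on \<Omega>. \<sigma> x = wgrad \<Omega> u x"
      "\<sigma> \<in> Qspace \<Omega> Agrad"
    using u\<sigma> h.minimizer_solves[OF wellposed f, of u \<sigma>] zero.minimizer_solves[OF wellposed f, of u \<sigma>]
    by (auto simp: J\<^sub>h_eq_ls_functional J\<^sub>0_eq_ls_functional)
  show ?thesis
    unfolding J\<^sub>h_eq_ls_functional J\<^sub>0_eq_ls_functional
      triple_norm\<^sub>h_eq_ls_functional triple_norm\<^sub>0_eq_ls_functional
    by (intro conjI allI impI exact Sk0_subset_H1 vec_space_Sk_subset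
        h.minimizer_best_approximation[OF f exact(1,3,2)]
        zero.minimizer_best_approximation[OF f exact(1,3,2)])
qed

end
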